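(* Let $\Omega\subset\mathbb{H}$ be a bounded domain. Assume that $f\in C(\overline{\Omega})$ satisfies $f=K$ on $\partial\Omega$ and $f\le K$ in $\overline{\Omega}$ for some $K\in\mathbb{R}$. Assume that there exists a subsolution $\underline{u}\in C(\overline{\Omega})$ of $$u(p)+H(p,u(p),\nabla_Hu(p))=f(p)\quad\text{in }\Omega\qquad(\ast)$$ satisfying $\underline{u}=K$ on $\partial\Omega$. For $p\in\overline{\Omega}$ let $$U(p)=\sup\{u(p):\ u\in USC(\overline{\Omega})\text{ is a subsolution of }(\ast)\text{ with }u\le f\text{ on }\partial\Omega\},$$ and let $U^*$ be the upper semicontinuous envelope of $U$ on $\overline{\Omega}$. Then $U^*$ is continuous in $\overline{\Omega}$ and is the unique solution of $(\ast)$ satisfying $U^*\le f\le K$ in $\overline{\Omega}$ and $U^*=f=K$ on $\partial\Omega$.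
   Context: The Heisenberg group $\mathbb{H}$ is $\mathbb{R}^3$ (with its usual topology) with the group law $(x_p,y_p,z_p)\cdot(x_q,y_q,z_q)=(x_p+x_q,\,y_p+y_q,\,z_p+z_q+\frac12(x_py_q-x_qy_p))$. Let $\mathbb{H}_0=\{(x,y,0):x,y\in\mathbb{R}\}$ and, for $p\in\mathbb{H}$, $\mathbb{H}_p=\{p\cdot h:h\in\mathbb{H}_0\}$. For $\zeta=(x,y,z)\in\mathbb{H}$ write $\zeta_h=(x,y)$. With $X_1=\partial_x-\frac y2\partial_z$ and $X_2=\partial_y+\frac x2\partial_z$, the horizontal gradient is $\nabla_H\varphi=(X_1\varphi,X_2\varphi)$. A domain is a connected open set. $USC$ / $LSC$ denote upper / lower semicontinuous functions. For $u:\Omega\to\mathbb{R}$ and $p\in\Omega$ put $S_p(u)=\{\xi\in\mathbb{H}_p\cap\Omega:u(\xi)<u(p)\}$ and $\hat S_p(u)=\{\xi\in\mathbb{H}_p\cap\Omega:u(\xi)\le u(p)\}$. The equation $u+H(p,u,\nabla_Hu)=f$ in $\Omega$ is understood as follows. Subsolution ($f\in USC(\Omega)$ locally bounded): a locally bounded $u\in USC(\Omega)$ such that whenever $p\in\Omega$ and $\varphi\in C^1(\Omega)$ are such that $u-\varphi$ attains a maximum at $p$, one has $u(p)+\sup\{\langle\nabla_H\varphi(p),(p^{-1}\cdot\xi)_h\rangle:\xi\in S_p(u)\}\le f(p)$, the supremum being taken as $0$ if $\nabla_H\varphi(p)=0$. Supersolution ($f\in LSC(\Omega)$ locally bounded):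 a locally bounded $u\in LSC(\Omega)$ such that whenever $p\in\Omega$ and $\varphi\in C^1(\Omega)$ are such that $u-\varphi$ attains a minimum at $p$, one has $u(p)+\sup\{\langle\nabla_H\varphi(p),(p^{-1}\cdot\xi)_h\rangle:\xi\in\hat S_p(u)\}\ge f(p)$. A solution is a continuous function that is both a subsolution and a supersolution. *)

theory Defs
  imports "HOL-Analysis.Analysis"
begin

section \<open>The Heisenberg group\<close>

type_synonym heis = "real \<times> real \<times> real"

definition hmul :: "heis \<Rightarrow> heis \<Rightarrow> heis" where
  "hmul p q = (case p of (xp, yp, zp) \<Rightarrow> case q of (xq, yq, zq) \<Rightarrow>
     (xp + xq, yp + yq, zp + zq + (xp * yq - xq * yp) / 2))"

definition hinv :: "heis \<Rightarrow> heis" where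
  "hinv p = (case p of (x, y, z) \<Rightarrow> (- x, - y, - z))"

lemma hmul_hinv: "hmul p (hinv p) = (0, 0, 0)" "hmul (hinv p) p = (0, 0, 0)"
  by (cases p; simp add: hmul_def hinv_def)+

definition horiz :: "heis \<Rightarrow> real \<times> real" where
  "horiz \<zeta> = (case \<zeta> of (x, y, z) \<Rightarrow> (x, y))"

definition H0 :: "heis set" where
  "H0 = {(x, y, 0) | x y. True}"

definition horizontal_plane :: "heis \<Rightarrow> heis set" where
  "horizontal_plane p = hmul p ` H0"

text \<open>Functions on a set \<open>\<Omega>\<close> are total functions of which only the values on \<open>\<Omega>\<close> are used.
  The derivative of a function that is differentiable on an open set \<open>\<Omega>\<close> depends, at the points
  of \<open>\<Omega>\<close>, only on the values on \<open>\<Omega>\<close>.\<close>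

definition C1_on :: "heis set \<Rightarrow> (heis \<Rightarrow> real) \<Rightarrow> bool" where
  "C1_on \<Omega> \<phi> \<longleftrightarrow> (\<forall>p\<in>\<Omega>. \<phi> differentiable (at p)) \<and>
     (\<forall>v. continuous_on \<Omega> (\<lambda>p. frechet_derivative \<phi> (at p) v))"

definition partial_x :: "(heis \<Rightarrow> real) \<Rightarrow> heis \<Rightarrow> real" where
  "partial_x \<phi> p = frechet_derivative \<phi> (at p) (1, 0, 0)"

definition partial_y :: "(heis \<Rightarrow> real) \<Rightarrow> heis \<Rightarrow> real" where
  "partial_y \<phi> p = frechet_derivative \<phi> (at p) (0, 1, 0)"

definition partial_z :: "(heis \<Rightarrow> real) \<Rightarrow> heis \<Rightarrow> real" where
  "partial_z \<phi> p = frechet_derivative \<phi> (at p) (0, 0, 1)"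

definition X1 :: "(heis \<Rightarrow> real) \<Rightarrow> heis \<Rightarrow> real" where
  "X1 \<phi> p = (case p of (x, y, z) \<Rightarrow> partial_x \<phi> p - y / 2 * partial_z \<phi> p)"

definition X2 :: "(heis \<Rightarrow> real) \<Rightarrow> heis \<Rightarrow> real" where
  "X2 \<phi> p = (case p of (x, y, z) \<Rightarrow> partial_y \<phi> p + x / 2 * partial_z \<phi> p)"

definition hgrad :: "(heis \<Rightarrow> real) \<Rightarrow> heis \<Rightarrow> real \<times> real" where
  "hgrad \<phi> p = (X1 \<phi> p, X2 \<phi> p)"

section \<open>Semicontinuity\<close>

definition usc_on :: "heis set \<Rightarrow> (heis \<Rightarrow> real) \<Rightarrow> bool" where
  "usc_on S u \<longleftrightarrow> (\<forall>p\<in>S. \<forall>a. u p < a \<longrightarrow> (\<forall>\<^sub>F q in at p within S. u q < a))"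

definition lsc_on :: "heis set \<Rightarrow> (heis \<Rightarrow> real) \<Rightarrow> bool" where
  "lsc_on S u \<longleftrightarrow> (\<forall>p\<in>S. \<forall>a. a < u p \<longrightarrow> (\<forall>\<^sub>F q in at p within S. a < u q))"

definition locally_bounded_on :: "heis set \<Rightarrow> (heis \<Rightarrow> real) \<Rightarrow> bool" where
  "locally_bounded_on S u \<longleftrightarrow> (\<forall>p\<in>S. \<exists>r>0. bounded (u ` (S \<inter> ball p r)))"

definition usc_envelope :: "heis set \<Rightarrow> (heis \<Rightarrow> ereal) \<Rightarrow> heis \<Rightarrow> ereal" where
  "usc_envelope S U p = (INF r\<in>{0<..}. SUP q\<in>S \<inter> ball p r. U q)"

section \<open>The nonlocal Hamilton-Jacobi equation\<close>

definition sublevel :: "heis set \<Rightarrow> (heis \<Rightarrow> real) \<Rightarrow> heis \<Rightarrow> heis set" where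
  "sublevel \<Omega> u p = {\<xi> \<in> horizontal_plane p \<inter> \<Omega>. u \<xi> < u p}"

definition sublevel_le :: "heis set \<Rightarrow> (heis \<Rightarrow> real) \<Rightarrow> heis \<Rightarrow> heis set" where
  "sublevel_le \<Omega> u p = {\<xi> \<in> horizontal_plane p \<inter> \<Omega>. u \<xi> \<le> u p}"

text \<open>The suprema are taken in the extended reals, because they may be infinite when \<open>\<Omega>\<close> is
  unbounded.  The set \<open>sublevel_le \<Omega> u p\<close> contains \<open>p\<close>.  If \<open>sublevel \<Omega> u p\<close> is empty and
  \<open>u - \<phi>\<close> has a maximum at \<open>p\<close>, then \<open>\<phi>\<close> has a local minimum at \<open>p\<close> along the horizontal plane,
  so \<open>hgrad \<phi> p = 0\<close>; hence the case distinction below covers every occurrence of an empty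
  supremum.\<close>

definition subsolution :: "heis set \<Rightarrow> (heis \<Rightarrow> real) \<Rightarrow> (heis \<Rightarrow> real) \<Rightarrow> bool" where
  "subsolution \<Omega> f u \<longleftrightarrow>
     usc_on \<Omega> f \<and> locally_bounded_on \<Omega> f \<and>
     usc_on \<Omega> u \<and> locally_bounded_on \<Omega> u \<and>
     (\<forall>p\<in>\<Omega>. \<forall>\<phi>. C1_on \<Omega> \<phi> \<and> (\<forall>q\<in>\<Omega>. u q - \<phi> q \<le> u p - \<phi> p) \<longrightarrow>
        ereal (u p) +
          (if hgrad \<phi> p = 0 then 0
           else (SUP \<xi>\<in>sublevel \<Omega> u p. ereal (hgrad \<phi> p \<bullet> horiz (hmul (hinv p) \<xi>))))
        \<le> ereal (f p))"

definition supersolution :: "heis set \<Rightarrow> (heis \<Rightarrow> real) \<Rightarrow> (heis \<Rightarrow> real) \<Rightarrow> bool" where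
  "supersolution \<Omega> f u \<longleftrightarrow>
     lsc_on \<Omega> f \<and> locally_bounded_on \<Omega> f \<and>
     lsc_on \<Omega> u \<and> locally_bounded_on \<Omega> u \<and>
     (\<forall>p\<in>\<Omega>. \<forall>\<phi>. C1_on \<Omega> \<phi> \<and> (\<forall>q\<in>\<Omega>. u p - \<phi> p \<le> u q - \<phi> q) \<longrightarrow>
        ereal (f p) \<le>
        ereal (u p) +
          (SUP \<xi>\<in>sublevel_le \<Omega> u p. ereal (hgrad \<phi> p \<bullet> horiz (hmul (hinv p) \<xi>))))"

definition solution :: "heis set \<Rightarrow> (heis \<Rightarrow> real) \<Rightarrow> (heis \<Rightarrow> real) \<Rightarrow> bool" where
  "solution \<Omega> f u \<longleftrightarrow> continuous_on \<Omega> u \<and> subsolution \<Omega> f u \<and> supersolution \<Omega> f u"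

definition perron :: "heis set \<Rightarrow> (heis \<Rightarrow> real) \<Rightarrow> heis \<Rightarrow> ereal" where
  "perron \<Omega> f p =
     (SUP u\<in>{u. usc_on (closure \<Omega>) u \<and> subsolution \<Omega> f u \<and> (\<forall>q\<in>frontier \<Omega>. u q \<le> f q)}.
        ereal (u p))"

end

theory Submission
  imports Defs
begin

text \<open>The comparison principle is proved by doubling variables with the penalty \<open>n |p q\<inverse>|\<^sup>2\<close>.  At a
  maximum \<open>(p, q)\<close> of \<open>u(p) - v(q) - n |p q\<inverse>|\<^sup>2\<close> the two test functions have the same horizontal
  gradient, and a point \<open>\<eta> = q h\<close> of the horizontal plane at \<open>q\<close> corresponds to \<open>\<xi> = p h\<close> with
  \<open>\<xi> \<eta>\<inverse> = p q\<inverse>\<close>; maximality then gives \<open>u(\<xi>) \<le> u(p)\<close> whenever \<open>v(\<eta>) \<le> v(q)\<close>.  The boundary data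
  enter through \<open>v(q) < K\<close>, which keeps \<open>\<eta>\<close>, hence \<open>\<xi>\<close>, inside \<open>\<Omega>\<close>.
  Perron's method then applies: the upper envelope of the supremum is itself a subsolution, a bump
  argument shows that its lower envelope is a supersolution, and comparison identifies the two.\<close>

text \<open>The equation is nonlocal: the inequality at a point involves values at distant points of
  its horizontal plane, so every limit has to carry those points along. Horizontal planes are left
  cosets of \<open>H0\<close>; the same displacement h is applied at p and at q by right
  multiplication, and p q^-1 ignores it, whereas the left-invariant q^-1 p would be conjugated by h.
  The two sublevel sets behave differently. The strict inequality for subsolutions is stable under
  small perturbations, which suits suprema of subsolutions; the weak one for supersolutions is
  stable under limits, which suits the bump argument. Comparison has to turn the weak inequality for
  v into a strict one for u, and pays with a short step back along a segment. The number K rules out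
  escape to the frontier: subsolutions in the Perron family lie below f, hence below K, while the
  supersolution is at least K on the frontier, so a limit point with value below K is interior. The
  given subsolution is continuous, so it stays below the lower envelope as well and forces the value
  K there.\<close>

section \<open>Coordinates, group identities and horizontal planes\<close>

lemma horiz_eq: "horiz \<zeta> = (fst \<zeta>, fst (snd \<zeta>))"
  by (cases \<zeta>) (simp add: horiz_def)

lemma hmul_eq:
  "hmul p q = (fst p + fst q, fst (snd p) + fst (snd q),
     snd (snd p) + snd (snd q) + (fst p * fst (snd q) - fst q * fst (snd p)) / 2)"
  by (cases p; cases q) (simp add: hmul_def)

lemma hinv_eq: "hinv p = - p"
  by (cases p) (simp add: hinv_def)

lemma hmul_hinv_cancel: "hmul p (hmul (hinv p) q) = q"
  by (simp add: hmul_eq hinv_eq prod_eq_iff field_simps)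

lemma hinv_hmul_cancel: "hmul (hinv p) (hmul p q) = q"
  by (simp add: hmul_eq hinv_eq prod_eq_iff field_simps)

text \<open>A continuous equation in place of an image, so that membership survives limits of both
  the point and the base point.\<close>

lemma mem_horizontal_plane: "\<xi> \<in> horizontal_plane p \<longleftrightarrow> snd (snd (hmul (hinv p) \<xi>)) = 0"
proof
  assume "\<xi> \<in> horizontal_plane p"
  then obtain x y where "\<xi> = hmul p (x, y, 0)"
    by (auto simp: horizontal_plane_def H0_def)
  then show "snd (snd (hmul (hinv p) \<xi>)) = 0"
    by (simp add: hinv_hmul_cancel)
next
  assume "snd (snd (hmul (hinv p) \<xi>)) = 0"
  then obtain x y where xy: "hmul (hinv p) \<xi> = (x, y, 0)"
    by (cases "hmul (hinv p) \<xi>") simp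
  have "\<xi> = hmul p (x, y, 0)"
    unfolding xy[symmetric] by (rule hmul_hinv_cancel[symmetric])
  then show "\<xi> \<in> horizontal_plane p"
    by (auto simp: horizontal_plane_def H0_def)
qed

lemma horizontal_planeE:
  assumes "\<xi> \<in> horizontal_plane p"
  obtains a b where "\<xi> = hmul p (a, b, 0)" "horiz (hmul (hinv p) \<xi>) = (a, b)"
  using assms that by (auto simp: horizontal_plane_def H0_def hinv_hmul_cancel horiz_def)

lemma hmul_in_horizontal_plane: "hmul p (a, b, 0) \<in> horizontal_plane p"
  by (auto simp: horizontal_plane_def H0_def)

lemma tendsto_hmul [tendsto_intros]:
  "(X \<longlongrightarrow> p) F \<Longrightarrow> (Y \<longlongrightarrow> q) F \<Longrightarrow> ((\<lambda>x. hmul (X x) (Y x)) \<longlongrightarrow> hmul p q) F"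
  unfolding hmul_eq by (intro tendsto_intros) simp_all

lemma tendsto_hinv [tendsto_intros]:
  "(X \<longlongrightarrow> p) F \<Longrightarrow> ((\<lambda>x. hinv (X x)) \<longlongrightarrow> hinv p) F"
  unfolding hinv_eq by (intro tendsto_intros)

lemma tendsto_horiz [tendsto_intros]:
  "(X \<longlongrightarrow> p) F \<Longrightarrow> ((\<lambda>x. horiz (X x)) \<longlongrightarrow> horiz p) F"
  unfolding horiz_eq by (intro tendsto_intros)

section \<open>Semicontinuous functions\<close>

lemma usc_on_dist:
  "usc_on S u \<longleftrightarrow> (\<forall>p\<in>S. \<forall>a. u p < a \<longrightarrow> (\<exists>d>0. \<forall>q\<in>S. dist q p < d \<longrightarrow> u q < a))"
proof -
  have "(\<forall>\<^sub>F q in at p within S. u q < a) \<longleftrightarrow> (\<exists>d>0. \<forall>q\<in>S. dist q p < d \<longrightarrow> u q < a)"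
    if "u p < a" for p a
    unfolding eventually_at by (metis that)
  then show ?thesis
    by (simp add: usc_on_def)
qed

lemma lsc_on_uminus: "lsc_on S u \<longleftrightarrow> usc_on S (\<lambda>x. - u x)"
  unfolding lsc_on_def usc_on_def
proof (intro ball_cong refl iffI allI impI)
  fix p a
  assume *: "\<forall>a. a < u p \<longrightarrow> (\<forall>\<^sub>F q in at p within S. a < u q)" and "- u p < a"
  then have "\<forall>\<^sub>F q in at p within S. - a < u q" by (metis minus_less_iff)
  then show "\<forall>\<^sub>F q in at p within S. - u q < a" by (rule eventually_mono) simp
next
  fix p a
  assume *: "\<forall>a. - u p < a \<longrightarrow> (\<forall>\<^sub>F q in at p within S. - u q < a)" and "a < u p"
  then have "\<forall>\<^sub>F q in at p within S. - u q < - a" by (metis neg_less_iff_less)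
  then show "\<forall>\<^sub>F q in at p within S. a < u q" by (rule eventually_mono) simp
qed

lemma usc_on_subset: "usc_on S u \<Longrightarrow> T \<subseteq> S \<Longrightarrow> usc_on T u"
  unfolding usc_on_dist by (meson subsetD)

lemma lsc_on_subset: "lsc_on S u \<Longrightarrow> T \<subseteq> S \<Longrightarrow> lsc_on T u"
  unfolding lsc_on_uminus by (rule usc_on_subset)

lemma continuous_on_imp_usc_on: "continuous_on S u \<Longrightarrow> usc_on S u"
  unfolding usc_on_def continuous_on_def by (blast dest: order_tendstoD(2))

lemma continuous_on_imp_lsc_on: "continuous_on S u \<Longrightarrow> lsc_on S u"
  unfolding lsc_on_def continuous_on_def by (blast dest: order_tendstoD(1))

lemma usc_lsc_imp_continuous_on: "usc_on S u \<Longrightarrow> lsc_on S u \<Longrightarrow> continuous_on S u"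
  unfolding lsc_on_def usc_on_def continuous_on_def by (simp add: order_tendstoI)

lemma usc_on_eventually:
  assumes "usc_on S u" "p \<in> S" "(X \<longlongrightarrow> p) F" "\<forall>\<^sub>F n in F. X n \<in> S" "u p < a"
  shows "\<forall>\<^sub>F n in F. u (X n) < a"
proof -
  obtain d where d: "d > 0" "\<forall>q\<in>S. dist q p < d \<longrightarrow> u q < a"
    using assms(1,2,5) unfolding usc_on_dist by blast
  have "\<forall>\<^sub>F n in F. dist (X n) p < d"
    using tendstoD[OF assms(3) d(1)] .
  with assms(4) show ?thesis
    by eventually_elim (use d(2) in blast)
qed

lemma lsc_on_eventually:
  assumes "lsc_on S u" "p \<in> S" "(X \<longlongrightarrow> p) F" "\<forall>\<^sub>F n in F. X n \<in> S" "a < u p"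
  shows "\<forall>\<^sub>F n in F. a < u (X n)"
  using usc_on_eventually[OF assms(1)[unfolded lsc_on_uminus] assms(2,3,4), of "- a"] assms(5)
  by simp

lemma usc_on_diff_continuous:
  assumes "usc_on S u" "continuous_on S g"
  shows "usc_on S (\<lambda>x. u x - g x)"
  unfolding usc_on_def
proof (intro ballI allI impI)
  fix p a assume p: "p \<in> S" and a: "u p - g p < a"
  define e where "e = (a - (u p - g p)) / 2"
  have e: "e > 0" using a by (simp add: e_def)
  have "\<forall>\<^sub>F q in at p within S. u q < u p + e"
    using assms(1) p e unfolding usc_on_def by simp
  moreover have "\<forall>\<^sub>F q in at p within S. g p - e < g q"
    by (rule order_tendstoD(1)[OF assms(2)[unfolded continuous_on_def, rule_format, OF p]]) (use e in simp)
  ultimately show "\<forall>\<^sub>F q in at p within S. u q - g q < a"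
    by eventually_elim (simp add: e_def field_simps)
qed

text \<open>Without a maximum, each p has a ball on which u stays below some value
  \<open>u (Q p)\<close>. Among finitely many balls covering S, the largest such value is
  contradicted by the ball containing its own \<open>Q p\<close>. A general metric space is allowed
  because the doubling argument maximises over a product, to which \<open>usc_on\<close> does not
  apply.\<close>

lemma usc_attains_max:
  fixes u :: "'a::metric_space \<Rightarrow> real"
  assumes "compact S" "S \<noteq> {}"
    and usc: "\<And>p a. p \<in> S \<Longrightarrow> u p < a \<Longrightarrow> \<exists>d>0. \<forall>q\<in>S. dist q p < d \<longrightarrow> u q < a"
  obtains p where "p \<in> S" "\<And>q. q \<in> S \<Longrightarrow> u q \<le> u p"
proof (rule ccontr)
  assume "\<not> thesis"
  then have "\<forall>p\<in>S. \<exists>q\<in>S. u p < u q"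
    using that by (meson not_le)
  then obtain Q where Q: "\<And>p. p \<in> S \<Longrightarrow> Q p \<in> S \<and> u p < u (Q p)" by metis
  then have "\<forall>p\<in>S. \<exists>d>0. \<forall>q\<in>S. dist q p < d \<longrightarrow> u q < u (Q p)"
    using usc by blast
  then obtain d where d: "\<And>p. p \<in> S \<Longrightarrow> d p > 0 \<and> (\<forall>q\<in>S. dist q p < d p \<longrightarrow> u q < u (Q p))"
    by metis
  have "S \<subseteq> (\<Union>p\<in>S. ball p (d p))" using d by force
  then obtain T where T: "T \<subseteq> S" "finite T" "S \<subseteq> (\<Union>p\<in>T. ball p (d p))"
    using compactE_image[OF assms(1), of S "\<lambda>p. ball p (d p)"] by auto
  have "T \<noteq> {}" using T(3) assms(2) by auto
  let ?M = "Max ((\<lambda>p. u (Q p)) ` T)"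
  have "?M \<in> (\<lambda>p. u (Q p)) ` T"
    using T(2) \<open>T \<noteq> {}\<close> by (intro Max_in) auto
  then obtain p where p1: "p \<in> T" "u (Q p) = ?M" by force
  have p2: "u (Q q) \<le> u (Q p)" if "q \<in> T" for q
    unfolding p1(2) using T(2) that by (intro Max_ge) auto
  have "Q p \<in> S" using Q T(1) p1(1) by auto
  then obtain q where q: "q \<in> T" "dist q (Q p) < d q" using T(3) by auto
  then have "u (Q p) < u (Q q)"
    using d[of q] T(1) \<open>Q p \<in> S\<close> by (auto simp: dist_commute)
  with p2[OF q(1)] show False by simp
qed

lemma usc_on_attains_max:
  assumes "compact S" "S \<noteq> {}" "usc_on S u"
  obtains p where "p \<in> S" "\<And>q. q \<in> S \<Longrightarrow> u q \<le> u p"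
proof (rule usc_attains_max[OF assms(1,2), of u])
  show "\<exists>d>0. \<forall>q\<in>S. dist q p < d \<longrightarrow> u q < a" if "p \<in> S" "u p < a" for p a
    using assms(3) that unfolding usc_on_dist by blast
qed (use that in blast)

lemma locally_bounded_on_bounded:
  assumes "\<And>p. p \<in> S \<Longrightarrow> b \<le> u p" "\<And>p. p \<in> S \<Longrightarrow> u p \<le> B"
  shows "locally_bounded_on S u"
  unfolding locally_bounded_on_def
proof (intro ballI exI conjI)
  fix p
  show "bounded (u ` (S \<inter> ball p 1))"
    by (rule bounded_subset[OF bounded_closed_interval[of b B]]) (use assms in auto)
qed simp

text \<open>Passes from extended to real values: the two bounds make the envelope finite on S. The
  last conclusion is the minimality of the envelope in the form used later, namely that its values
  are nearly reached by U at nearby points. Applied to a negated function it yields lower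
  envelopes.\<close>

lemma usc_envelope_real:
  assumes S: "\<And>p. p \<in> S \<Longrightarrow> ereal b \<le> U p" "\<And>p. p \<in> S \<Longrightarrow> U p \<le> ereal B"
  obtains w where "\<And>p. p \<in> S \<Longrightarrow> usc_envelope S U p = ereal (w p)"
    "usc_on S w" "\<And>p. p \<in> S \<Longrightarrow> U p \<le> ereal (w p)" "\<And>p. p \<in> S \<Longrightarrow> b \<le> w p \<and> w p \<le> B"
    "\<And>p d c. p \<in> S \<Longrightarrow> d > 0 \<Longrightarrow> c < w p \<Longrightarrow> \<exists>x\<in>S. dist x p < d \<and> ereal c < U x"
proof -
  define W where "W = usc_envelope S U"
  have ge: "U p \<le> W p" if "p \<in> S" for p
    unfolding W_def usc_envelope_def using that by (intro INF_greatest SUP_upper) auto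
  have le: "W p \<le> ereal B" for p
    unfolding W_def usc_envelope_def
    by (rule INF_lower2[of 1]) (auto intro!: SUP_least S)
  define w where "w = (\<lambda>p. real_of_ereal (W p))"
  have fin: "W p = ereal (w p)" if "p \<in> S" for p
    unfolding w_def using ge[OF that] le[of p] S(1)[OF that] by (cases "W p") auto
  show thesis
  proof (rule that[of "w"])
    show "usc_envelope S U p = ereal (w p)" if "p \<in> S" for p
      using fin[OF that] by (simp add: W_def)
    show "U p \<le> ereal (w p)" if "p \<in> S" for p
      using fin[OF that] ge[OF that] by simp
    show "b \<le> w p \<and> w p \<le> B" if "p \<in> S" for p
    proof -
      have "ereal b \<le> W p" "W p \<le> ereal B"
        using ge[OF that] le[of p] S(1)[OF that] by auto
      then show ?thesis by (simp add: fin[OF that])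
    qed
    show "usc_on S w"
      unfolding usc_on_dist
    proof (intro ballI allI impI)
      fix p a assume p: "p \<in> S" and a: "w p < a"
      then have "W p < ereal a" using fin by (metis less_ereal.simps(1))
      then obtain r where r: "r > 0" "(SUP q\<in>S \<inter> ball p r. U q) < ereal a"
        unfolding W_def usc_envelope_def INF_less_iff by auto
      show "\<exists>d>0. \<forall>q\<in>S. dist q p < d \<longrightarrow> w q < a"
      proof (intro exI[of _ r] conjI ballI impI r(1))
        fix q assume q: "q \<in> S" "dist q p < r"
        have sp: "dist p x < r" if "dist q x < r - dist q p" for x
          using dist_triangle[of p x q] that by (simp add: dist_commute)
        have "W q \<le> (SUP x\<in>S \<inter> ball q (r - dist q p). U x)"
          unfolding W_def usc_envelope_def by (rule INF_lower) (use q in simp)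
        also have "\<dots> \<le> (SUP x\<in>S \<inter> ball p r. U x)"
          by (rule SUP_subset_mono) (use q in \<open>auto intro: sp\<close>)
        also note r(2)
        finally show "w q < a"
          using fin[OF q(1)] by (metis less_ereal.simps(1))
      qed
    qed
    fix p :: heis and d c :: real assume p: "p \<in> S" "d > 0" "c < w p"
    then have "ereal c < W p" using fin by (metis less_ereal.simps(1))
    also have "W p \<le> (SUP q\<in>S \<inter> ball p d. U q)"
      unfolding W_def usc_envelope_def by (rule INF_lower) (use p in simp)
    finally show "\<exists>x\<in>S. dist x p < d \<and> ereal c < U x"
      by (auto simp: less_SUP_iff dist_commute)
  qed
qed

section \<open>Test functions\<close>

lemma C1_onI:
  assumes "\<And>p. p \<in> \<Omega> \<Longrightarrow> (\<phi> has_derivative D p) (at p)"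
    and "\<And>v. continuous_on \<Omega> (\<lambda>p. D p v)"
  shows "C1_on \<Omega> \<phi>"
  unfolding C1_on_def
proof (intro conjI ballI allI)
  show "\<phi> differentiable at p" if "p \<in> \<Omega>" for p
    using assms(1)[OF that] by (rule differentiableI)
  show "continuous_on \<Omega> (\<lambda>p. frechet_derivative \<phi> (at p) v)" for v
    using assms(2)[of v] by (rule continuous_on_eq) (metis assms(1) frechet_derivative_at)
qed

text \<open>The two vectors are the fields X_1 and X_2 at p; linearity of \<open>D\<close> splits
  them into coordinate directions.\<close>

lemma hgrad_eq:
  assumes "(\<phi> has_derivative D) (at p)"
  shows "hgrad \<phi> p = (D (1, 0, - fst (snd p) / 2), D (0, 1, fst p / 2))"
proof -
  obtain x y z where p: "p = (x, y, z)" by (cases p)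
  have D: "frechet_derivative \<phi> (at p) = D" using assms by (metis frechet_derivative_at)
  interpret bounded_linear D using assms by (rule has_derivative_bounded_linear)
  have "D (1, 0, - y / 2) = D ((1, 0, 0) + (- y / 2) *\<^sub>R (0, 0, 1))" by simp
  also have "\<dots> = D (1, 0, 0) - y / 2 * D (0, 0, 1)" unfolding add scaleR by simp
  moreover have "D (0, 1, x / 2) = D ((0, 1, 0) + (x / 2) *\<^sub>R (0, 0, 1))" by simp
  then have "D (0, 1, x / 2) = D (0, 1, 0) + x / 2 * D (0, 0, 1)" unfolding add scaleR by simp
  ultimately show ?thesis
    using D unfolding p by (simp add: hgrad_def X1_def X2_def partial_x_def partial_y_def partial_z_def)
qed

lemma C1_on_has_derivative:
  "C1_on \<Omega> \<phi> \<Longrightarrow> p \<in> \<Omega> \<Longrightarrow> (\<phi> has_derivative frechet_derivative \<phi> (at p)) (at p)"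
  unfolding C1_on_def using frechet_derivative_works by blast

lemma C1_on_continuous: "C1_on \<Omega> \<phi> \<Longrightarrow> continuous_on \<Omega> \<phi>"
  unfolding C1_on_def
  by (meson continuous_at_imp_continuous_on differentiable_imp_continuous_within)

lemma continuous_on_hgrad:
  assumes "C1_on \<Omega> \<phi>"
  shows "continuous_on \<Omega> (hgrad \<phi>)"
proof -
  have "continuous_on \<Omega> (\<lambda>p. frechet_derivative \<phi> (at p) v)" for v
    using assms unfolding C1_on_def by blast
  note c = this
  have "hgrad \<phi> = (\<lambda>p. (partial_x \<phi> p - fst (snd p) / 2 * partial_z \<phi> p,
      partial_y \<phi> p + fst p / 2 * partial_z \<phi> p))"
    by (rule ext) (simp add: hgrad_def X1_def X2_def split_beta)
  then show ?thesis
    unfolding partial_x_def partial_y_def partial_z_def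
    by (simp only:) (intro continuous_intros c; simp)
qed

lemma C1_on_add:
  assumes "C1_on \<Omega> \<phi>" "C1_on \<Omega> \<psi>"
  shows "C1_on \<Omega> (\<lambda>p. \<phi> p + \<psi> p)"
proof (rule C1_onI)
  show "((\<lambda>p. \<phi> p + \<psi> p) has_derivative
     (\<lambda>v. frechet_derivative \<phi> (at p) v + frechet_derivative \<psi> (at p) v)) (at p)" if "p \<in> \<Omega>" for p
    using that assms by (intro has_derivative_add C1_on_has_derivative)
  show "continuous_on \<Omega> (\<lambda>p. frechet_derivative \<phi> (at p) v + frechet_derivative \<psi> (at p) v)" for v
    by (rule continuous_on_add) (use assms in \<open>unfold C1_on_def, blast+\<close>)
qed

lemma has_derivative_sqdist:
  "((\<lambda>q. c * ((q - p) \<bullet> (q - p)) + k) has_derivative (\<lambda>v. c * (2 * ((q - p) \<bullet> v)))) (at q)"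
  for p :: heis
  by (auto intro!: derivative_eq_intros simp: inner_commute)

lemma C1_on_sqdist: "C1_on \<Omega> (\<lambda>q. c * ((q - p) \<bullet> (q - p)) + k)"
  by (rule C1_onI[OF has_derivative_sqdist]) (intro continuous_intros)

text \<open>The quadratic is critical at its centre. Adding it makes a contact point strict without
  changing the gradient being tested; \<open>k\<close> normalises the contact value.\<close>

lemma hgrad_add_sqdist:
  assumes "C1_on \<Omega> \<phi>" "p \<in> \<Omega>"
  shows "hgrad (\<lambda>q. \<phi> q + (c * ((q - p) \<bullet> (q - p)) + k)) p = hgrad \<phi> p"
  using hgrad_eq[OF has_derivative_add[OF C1_on_has_derivative[OF assms]
        has_derivative_sqdist[of c p k p]]]
    hgrad_eq[OF C1_on_has_derivative[OF assms]] by simp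

text \<open>The penalty of the doubling argument.  It depends on \<open>p q\<inverse>\<close> only, so its horizontal gradients
  in \<open>p\<close> and in \<open>q\<close> are opposite (\<open>rsq_grad_commute\<close>) and it does not change when \<open>p\<close> and \<open>q\<close> are
  both multiplied by \<open>h\<close> from the right.\<close>

definition rsq :: "heis \<Rightarrow> heis \<Rightarrow> real" where
  "rsq p q = (hmul p (hinv q)) \<bullet> (hmul p (hinv q))"

text \<open>Closed form of the horizontal gradient of \<open>rsq\<close> in its first argument
  (\<open>hgrad_rsq\<close>): with (a, b, c) the coordinates of p q^-1, X_1 c and X_2 c are minus
  half the sum of the y coordinates and half the sum of the x coordinates.\<close>

definition rsq_grad :: "heis \<Rightarrow> heis \<Rightarrow> real \<times> real" where
  "rsq_grad p q = (let (a, b, c) = hmul p (hinv q) in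
     (2 * a - c * (fst (snd p) + fst (snd q)), 2 * b + c * (fst p + fst q)))"

lemma rsq_eq:
  "rsq p q = (fst p - fst q)\<^sup>2 + (fst (snd p) - fst (snd q))\<^sup>2
     + (snd (snd p) - snd (snd q) + (fst q * fst (snd p) - fst p * fst (snd q)) / 2)\<^sup>2"
  by (simp add: rsq_def hmul_eq hinv_eq inner_prod_def power2_eq_square field_simps)

lemma rsq_nonneg: "0 \<le> rsq p q" by (simp add: rsq_def)

lemma rsq_self: "rsq p p = 0" by (simp add: rsq_eq)

lemma rsq_eq_0: "rsq p q = 0 \<Longrightarrow> p = q"
proof -
  assume "rsq p q = 0"
  then have "hmul p (hinv q) = 0" by (simp add: rsq_def)
  then show "p = q"
    by (cases p; cases q) (auto simp: hmul_def hinv_def zero_prod_def)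
qed

lemma rsq_commute: "rsq p q = rsq q p"
  unfolding rsq_eq by (simp add: power2_eq_square field_simps)

lemma rsq_grad_commute: "rsq_grad q p = - rsq_grad p q"
  by (cases p; cases q) (simp add: rsq_grad_def hmul_eq hinv_eq field_simps)

lemma tendsto_rsq [tendsto_intros]:
  "(X \<longlongrightarrow> p) F \<Longrightarrow> (Y \<longlongrightarrow> q) F \<Longrightarrow> ((\<lambda>x. rsq (X x) (Y x)) \<longlongrightarrow> rsq p q) F"
  unfolding rsq_def by (intro tendsto_intros)

lemma has_derivative_rsq:
  "((\<lambda>p. n * rsq p q) has_derivative
    (\<lambda>v. n * (2 * (fst p - fst q) * fst v + 2 * (fst (snd p) - fst (snd q)) * fst (snd v)
     + 2 * (snd (snd p) - snd (snd q) + (fst q * fst (snd p) - fst p * fst (snd q)) / 2)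
         * (snd (snd v) + (fst q * fst (snd v) - fst v * fst (snd q)) / 2)))) (at p)"
  unfolding rsq_eq
  by (auto intro!: derivative_eq_intros simp: field_simps)

lemma C1_on_rsq: "C1_on \<Omega> (\<lambda>p. n * rsq p q)"
  by (rule C1_onI[OF has_derivative_rsq]) (intro continuous_intros; simp)

lemma hgrad_rsq: "hgrad (\<lambda>p. n * rsq p q) p = n *\<^sub>R rsq_grad p q"
  unfolding hgrad_eq[OF has_derivative_rsq]
  by (cases p; cases q) (simp add: rsq_grad_def hmul_eq hinv_eq field_simps)

text \<open>Along a horizontal line through p the coordinates of p q^-1 are affine in t, so the
  expansion is exact, with \<open>R\<close> independent of t.\<close>

lemma rsq_horizontal:
  "\<exists>R. \<forall>t. rsq (hmul p (- t * a, - t * b, 0)) q = rsq p q - t * (rsq_grad p q \<bullet> (a, b)) + t\<^sup>2 * R"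
proof -
  obtain x y z where p: "p = (x, y, z)" by (cases p)
  obtain x' y' z' where q: "q = (x', y', z')" by (cases q)
  define R where "R = a\<^sup>2 + b\<^sup>2 + ((a * (y + y') - b * (x + x')) / 2)\<^sup>2"
  show ?thesis
    unfolding p q
    by (intro exI[of _ R] allI)
      (simp add: R_def rsq_eq rsq_grad_def hmul_eq hinv_eq power2_eq_square field_simps)
qed

text \<open>Parallel horizontal vectors commute, so the factor with 1 - t is the factor with -t
  followed by (a, b, 0), which cancels in p q^-1.\<close>

lemma rsq_hmul_segment:
  "rsq (hmul p ((1 - t) * a, (1 - t) * b, 0)) (hmul q (a, b, 0)) = rsq (hmul p (- t * a, - t * b, 0)) q"
  by (cases p; cases q) (simp add: rsq_eq hmul_eq power2_eq_square field_simps)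

section \<open>The comparison principle\<close>

lemma subsolution_test:
  assumes "subsolution \<Omega> f u" "p \<in> \<Omega>" "C1_on \<Omega> \<phi>" "\<And>q. q \<in> \<Omega> \<Longrightarrow> u q - \<phi> q \<le> u p - \<phi> p"
    and "hgrad \<phi> p \<noteq> 0" "\<xi> \<in> sublevel \<Omega> u p"
  shows "u p + hgrad \<phi> p \<bullet> horiz (hmul (hinv p) \<xi>) \<le> f p"
proof -
  let ?s = "SUP \<xi>\<in>sublevel \<Omega> u p. ereal (hgrad \<phi> p \<bullet> horiz (hmul (hinv p) \<xi>))"
  have "ereal (u p) + ?s \<le> ereal (f p)"
    using assms(1)[unfolded subsolution_def, THEN conjunct2, THEN conjunct2, THEN conjunct2,
        THEN conjunct2, rule_format, OF assms(2), of \<phi>] assms(3-5) by simp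
  moreover have "ereal (hgrad \<phi> p \<bullet> horiz (hmul (hinv p) \<xi>)) \<le> ?s"
    using assms(6) by (intro SUP_upper)
  then have "ereal (u p) + ereal (hgrad \<phi> p \<bullet> horiz (hmul (hinv p) \<xi>)) \<le> ereal (u p) + ?s"
    by (rule add_left_mono)
  ultimately have "ereal (u p) + ereal (hgrad \<phi> p \<bullet> horiz (hmul (hinv p) \<xi>)) \<le> ereal (f p)"
    by (rule order_trans[rotated])
  then show ?thesis by simp
qed

lemma subsolution_test_0:
  assumes "subsolution \<Omega> f u" "p \<in> \<Omega>" "C1_on \<Omega> \<phi>" "\<And>q. q \<in> \<Omega> \<Longrightarrow> u q - \<phi> q \<le> u p - \<phi> p"
    and "hgrad \<phi> p = 0"
  shows "u p \<le> f p"
proof -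
  have "ereal (u p) + 0 \<le> ereal (f p)"
    using assms(1)[unfolded subsolution_def, THEN conjunct2, THEN conjunct2, THEN conjunct2,
        THEN conjunct2, rule_format, OF assms(2), of \<phi>] assms(3-5) by simp
  then show ?thesis by simp
qed

text \<open>The supremum need not be attained; the slack \<open>e\<close> buys an actual point of
  the sublevel set.\<close>

lemma supersolution_test:
  assumes "supersolution \<Omega> f v" "p \<in> \<Omega>" "C1_on \<Omega> \<phi>" "\<And>q. q \<in> \<Omega> \<Longrightarrow> v p - \<phi> p \<le> v q - \<phi> q"
    and "e > 0"
  shows "\<exists>\<xi>\<in>sublevel_le \<Omega> v p. f p - e < v p + hgrad \<phi> p \<bullet> horiz (hmul (hinv p) \<xi>)"
proof (rule ccontr)
  assume "\<not> ?thesis"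
  then have "(SUP \<xi>\<in>sublevel_le \<Omega> v p. ereal (hgrad \<phi> p \<bullet> horiz (hmul (hinv p) \<xi>)))
      \<le> ereal (f p - e - v p)"
    by (intro SUP_least) (auto simp: not_less algebra_simps)
  then have "ereal (v p) + (SUP \<xi>\<in>sublevel_le \<Omega> v p. ereal (hgrad \<phi> p \<bullet> horiz (hmul (hinv p) \<xi>)))
      \<le> ereal (v p) + ereal (f p - e - v p)"
    by (rule add_left_mono)
  moreover have "ereal (f p) \<le> ereal (v p) +
      (SUP \<xi>\<in>sublevel_le \<Omega> v p. ereal (hgrad \<phi> p \<bullet> horiz (hmul (hinv p) \<xi>)))"
    using assms(1-4) unfolding supersolution_def by blast
  ultimately have "ereal (f p) \<le> ereal (v p) + ereal (f p - e - v p)"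
    by (rule order_trans[rotated])
  with \<open>e > 0\<close> show False by simp
qed

text \<open>The sublevel set in the definition is strict.  Near \<open>p (s h)\<close> it is reached by moving back
  towards \<open>p\<close> along the segment, where the penalty decreases to first order.\<close>

lemma subsolution_segment:
  assumes sub: "subsolution \<Omega> f u" and p: "p \<in> \<Omega>"
    and max: "\<And>x. x \<in> \<Omega> \<Longrightarrow> u x - n * rsq x q \<le> u p - n * rsq p q"
    and pos: "n * (rsq_grad p q \<bullet> (a, b)) > 0"
    and \<Omega>: "\<forall>\<^sub>F t in at_right 0. hmul p ((s - t) * a, (s - t) * b, 0) \<in> \<Omega>"
    and dec: "\<And>t. t > 0 \<Longrightarrow> hmul p ((s - t) * a, (s - t) * b, 0) \<in> \<Omega> \<Longrightarrow>
      u (hmul p ((s - t) * a, (s - t) * b, 0))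
        \<le> u p + n * (rsq (hmul p (- t * a, - t * b, 0)) q - rsq p q)"
  shows "u p + s * (n * (rsq_grad p q \<bullet> (a, b))) \<le> f p"
proof -
  \<comment> \<open>\<open>m\<close> is the slope of the penalty along the segment. Its change is t
    (-m + t n R), negative for small t > 0, so \<open>dec\<close> becomes a strict inequality and
    the point is admissible in the definition. The resulting bound holds with s - t in place of s,
    and t tends to 0.\<close>
  define m where "m = n * (rsq_grad p q \<bullet> (a, b))"
  obtain R where R: "\<And>t. rsq (hmul p (- t * a, - t * b, 0)) q
      = rsq p q - t * (rsq_grad p q \<bullet> (a, b)) + t\<^sup>2 * R"
    using rsq_horizontal by metis
  have "((\<lambda>t. - m + t * (n * R)) \<longlongrightarrow> - m + 0 * (n * R)) (at_right 0)"
    by (intro tendsto_intros)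
  then have "\<forall>\<^sub>F t in at_right 0. - m + t * (n * R) < 0"
    by (rule order_tendstoD(2)) (use pos in \<open>simp add: m_def\<close>)
  moreover have "\<forall>\<^sub>F t in at_right 0. t > (0::real)"
    by (simp add: eventually_at_right_less)
  ultimately have ev: "\<forall>\<^sub>F t in at_right 0. u p + (s - t) * m \<le> f p"
    using \<Omega>
  proof eventually_elim
    case (elim t)
    let ?x = "hmul p ((s - t) * a, (s - t) * b, 0)"
    have "n * (rsq (hmul p (- t * a, - t * b, 0)) q - rsq p q) = t * (- m + t * (n * R))"
      unfolding R m_def by (simp add: algebra_simps power2_eq_square)
    also have "\<dots> < 0"
      using elim by (simp add: mult_pos_neg)
    finally have "?x \<in> sublevel \<Omega> u p"
      using dec[OF elim(2,3)] elim(3) by (simp add: sublevel_def hmul_in_horizontal_plane)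
    moreover have "hgrad (\<lambda>x. n * rsq x q) p \<noteq> 0"
      using pos by (auto simp: hgrad_rsq)
    ultimately have "u p + hgrad (\<lambda>x. n * rsq x q) p \<bullet> horiz (hmul (hinv p) ?x) \<le> f p"
      by (intro subsolution_test[OF sub p C1_on_rsq max])
    then show ?case
      by (simp add: hinv_hmul_cancel hgrad_rsq horiz_eq m_def inner_prod_def algebra_simps)
  qed
  have "((\<lambda>t. u p + (s - t) * m) \<longlongrightarrow> u p + (s - 0) * m) (at_right 0)"
    by (intro tendsto_intros)
  from tendsto_upperbound[OF this ev] show ?thesis
    by (simp add: m_def)
qed

text \<open>For a zero gradient this is the convention in the definition. Otherwise take (a, b) to
  be the gradient itself and s = 0: stepping from p against the gradient lowers u strictly, and the
  pairing with these points tends to 0.\<close>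

lemma subsolution_le_rsq:
  assumes sub: "subsolution \<Omega> f u" and p: "p \<in> \<Omega>" and "open \<Omega>"
    and max: "\<And>x. x \<in> \<Omega> \<Longrightarrow> u x - n * rsq x q \<le> u p - n * rsq p q"
  shows "u p \<le> f p"
proof (cases "n *\<^sub>R rsq_grad p q = 0")
  case True
  then show ?thesis
    by (intro subsolution_test_0[OF sub p C1_on_rsq max]) (simp_all add: hgrad_rsq)
next
  case False
  obtain a b where ab: "n *\<^sub>R rsq_grad p q = (a, b)" by (cases "n *\<^sub>R rsq_grad p q")
  have "(a, b) \<bullet> (a, b) > 0" using False unfolding ab by (simp only: inner_gt_zero_iff) simp
  then have pos: "n * (rsq_grad p q \<bullet> (a, b)) > 0"
    unfolding ab[symmetric] by simp
  have "((\<lambda>t. hmul p ((0 - t) * a, (0 - t) * b, 0)) \<longlongrightarrow> hmul p ((0 - 0) * a, (0 - 0) * b, 0)) (at_right 0)"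
    by (intro tendsto_intros)
  then have ev: "\<forall>\<^sub>F t in at_right 0. hmul p ((0 - t) * a, (0 - t) * b, 0) \<in> \<Omega>"
    by (rule topological_tendstoD[OF _ \<open>open \<Omega>\<close>]) (use p in \<open>simp add: hmul_eq\<close>)
  have "u p + 0 * (n * (rsq_grad p q \<bullet> (a, b))) \<le> f p"
  proof (rule subsolution_segment[OF sub p max pos ev])
    fix t :: real assume "hmul p ((0 - t) * a, (0 - t) * b, 0) \<in> \<Omega>"
    from max[OF this] show "u (hmul p ((0 - t) * a, (0 - t) * b, 0))
        \<le> u p + n * (rsq (hmul p (- t * a, - t * b, 0)) q - rsq p q)"
      by (simp add: right_diff_distrib)
  qed
  then show ?thesis by simp
qed

lemma bounded_convergent_subseq:
  fixes X :: "nat \<Rightarrow> heis"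
  assumes "bounded \<Omega>" "\<And>n. X n \<in> closure \<Omega>"
  obtains p r where "p \<in> closure \<Omega>" "strict_mono (r :: nat \<Rightarrow> nat)" "(\<lambda>n. X (r n)) \<longlonglongrightarrow> p"
proof -
  have "seq_compact (closure \<Omega>)"
    using assms(1) compact_closure compact_eq_seq_compact_metric by blast
  then show thesis
    using that seq_compactE[of "closure \<Omega>" X] assms(2) unfolding comp_def by blast
qed

text \<open>A test function need not touch u at p. Maximising u - n \<open>rsq\<close> (., p) over
  the closure gives points \<open>Y n\<close> with \<open>u p \<le> u (Y n)\<close> that converge to
  p along a subsequence; the previous bound holds at them and continuity of f carries it to
  p.\<close>

lemma subsolution_le:
  assumes "open \<Omega>" "bounded \<Omega>" and cf: "continuous_on \<Omega> f"
    and usc: "usc_on (closure \<Omega>) u" and sub: "subsolution \<Omega> f u" and p: "p \<in> \<Omega>"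
  shows "u p \<le> f p"
proof -
  let ?S = "closure \<Omega>"
  have S: "compact ?S" "?S \<noteq> {}" "p \<in> ?S"
    using \<open>bounded \<Omega>\<close> p closure_subset by auto
  have cr: "continuous_on ?S (\<lambda>x. real n * rsq x p)" for n
    by (rule C1_on_continuous[OF C1_on_rsq])
  have "\<exists>y. y \<in> ?S \<and> (\<forall>x\<in>?S. u x - real n * rsq x p \<le> u y - real n * rsq y p)" for n
    by (rule usc_on_attains_max[OF S(1,2) usc_on_diff_continuous[OF usc cr]]) blast
  then obtain Y where Y: "\<And>n. Y n \<in> ?S"
    "\<And>n x. x \<in> ?S \<Longrightarrow> u x - real n * rsq x p \<le> u (Y n) - real n * rsq (Y n) p"
    by metis
  obtain B where B: "\<And>x. x \<in> ?S \<Longrightarrow> u x \<le> B"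
    by (rule usc_on_attains_max[OF S(1,2) usc]) blast
  have le: "u p \<le> u (Y n)" "rsq (Y n) p \<le> (B - u p) / real n" if "n > 0" for n
  proof -
    have *: "u p \<le> u (Y n) - real n * rsq (Y n) p"
      using Y(2)[OF S(3), of n] by (simp add: rsq_self)
    then show "u p \<le> u (Y n)"
      using mult_nonneg_nonneg[OF of_nat_0_le_iff[of n] rsq_nonneg[of "Y n" p]] by linarith
    have "real n * rsq (Y n) p \<le> B - u p" using * B[OF Y(1)[of n]] by linarith
    then show "rsq (Y n) p \<le> (B - u p) / real n"
      using that by (simp add: field_simps)
  qed
  obtain q r where q: "q \<in> ?S" "strict_mono r" "(\<lambda>n. Y (r n)) \<longlonglongrightarrow> q"
    by (rule bounded_convergent_subseq[OF assms(2) Y(1)])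
  have rtop: "filterlim r at_top sequentially"
    using q(2) by (rule filterlim_subseq)
  have lim: "(\<lambda>n. rsq (Y (r n)) p) \<longlonglongrightarrow> rsq q p"
    by (intro tendsto_intros q(3))
  have r0: "\<forall>\<^sub>F n in sequentially. r n > 0"
    using eventually_compose_filterlim[OF eventually_gt_at_top rtop] .
  have "(\<lambda>n. (B - u p) / real (r n)) \<longlonglongrightarrow> 0"
    by (rule filterlim_compose[OF lim_const_over_n rtop])
  then have "rsq q p \<le> 0"
    by (rule tendsto_le[OF sequentially_bot _ lim]) (use r0 in eventually_elim, simp add: le(2))
  then have "q = p" using rsq_nonneg[of q p] rsq_eq_0[of q p] by simp
  with q(3) have Yp: "(\<lambda>n. Y (r n)) \<longlonglongrightarrow> p" by simp
  then have ev: "\<forall>\<^sub>F n in sequentially. Y (r n) \<in> \<Omega>"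
    using assms(1) p by (rule topological_tendstoD)
  have "(\<lambda>n. f (Y (r n))) \<longlonglongrightarrow> f p"
    using continuous_on_tendsto_compose[OF cf Yp p ev] .
  moreover have "\<forall>\<^sub>F n in sequentially. u p \<le> f (Y (r n))"
    using ev r0
  proof eventually_elim
    case (elim n)
    have "u (Y (r n)) \<le> f (Y (r n))"
      by (rule subsolution_le_rsq[OF sub elim(1) assms(1), where n = "real (r n)" and q = p])
        (use Y(2) closure_subset in blast)
    with le(1)[OF elim(2)] show ?case by simp
  qed
  ultimately show ?thesis
    by (intro tendsto_lowerbound) auto
qed

text \<open>The bound by K is asked of u on the whole closure and not only on the frontier: combined
  with a positive gap it pushes v at the doubled points strictly below K.\<close>

lemma comparison:
  assumes op: "open \<Omega>" and bd: "bounded \<Omega>" and cf: "continuous_on \<Omega> f"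
    and u: "usc_on (closure \<Omega>) u" "subsolution \<Omega> f u" "\<And>p. p \<in> closure \<Omega> \<Longrightarrow> u p \<le> K"
    and v: "lsc_on (closure \<Omega>) v" "supersolution \<Omega> f v" "\<And>p. p \<in> frontier \<Omega> \<Longrightarrow> K \<le> v p"
    and p1: "p1 \<in> closure \<Omega>"
  shows "u p1 \<le> v p1"
proof (rule ccontr)
  let ?S = "closure \<Omega>"
  define \<sigma> where "\<sigma> = u p1 - v p1"
  assume "\<not> ?thesis"
  then have \<sigma>: "\<sigma> > 0" by (simp add: \<sigma>_def)
  have S: "compact ?S" "?S \<noteq> {}" using bd p1 by auto
  have S\<Omega>: "x \<in> \<Omega> \<or> x \<in> frontier \<Omega>" if "x \<in> ?S" for x
    using that op by (auto simp: frontier_def interior_open)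
  have \<Omega>S: "x \<in> ?S" if "x \<in> \<Omega>" for x using that closure_subset by blast
  have vusc: "usc_on ?S (\<lambda>x. - v x)" using v(1) by (simp add: lsc_on_uminus)
  have "\<exists>y. y \<in> ?S \<times> ?S \<and> (\<forall>x\<in>?S \<times> ?S. u (fst x) - v (snd x) - real n * rsq (fst x) (snd x)
      \<le> u (fst y) - v (snd y) - real n * rsq (fst y) (snd y))" (is "\<exists>y. _ \<and> (\<forall>x\<in>_. ?F x \<le> ?F y)") for n
  proof (rule usc_attains_max[of "?S \<times> ?S" ?F])
    show "compact (?S \<times> ?S)" "?S \<times> ?S \<noteq> {}" using S by (auto intro: compact_Times)
    fix y :: "heis \<times> heis" and a assume y: "y \<in> ?S \<times> ?S" and a: "?F y < a"
    \<comment> \<open>One third of the gap for each of the three terms of \<open>?F\<close>.\<close>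
    define e where "e = (a - ?F y) / 3"
    have e: "e > 0" using a by (simp add: e_def)
    have "X + 3 * ((a - X) / 3) = a" for X by (simp add: field_simps)
    then have e3: "?F y + 3 * e = a" unfolding e_def .
    have "isCont (\<lambda>x. real n * rsq (fst x) (snd x)) y"
      unfolding isCont_def by (intro tendsto_intros)
    then obtain d3 where d3: "d3 > 0" "\<And>x. dist x y < d3 \<Longrightarrow>
        \<bar>real n * rsq (fst x) (snd x) - real n * rsq (fst y) (snd y)\<bar> < e"
      unfolding continuous_at_eps_delta dist_real_def using e by metis
    have "fst y \<in> ?S" "u (fst y) < u (fst y) + e" using y e by auto
    then obtain d1 where d1: "d1 > 0" "\<And>x. x \<in> ?S \<Longrightarrow> dist x (fst y) < d1 \<Longrightarrow> u x < u (fst y) + e"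
      using u(1) unfolding usc_on_dist by blast
    have "snd y \<in> ?S" "- v (snd y) < - v (snd y) + e" using y e by auto
    then obtain d2 where d2: "d2 > 0" "\<And>x. x \<in> ?S \<Longrightarrow> dist x (snd y) < d2 \<Longrightarrow> - v x < - v (snd y) + e"
      using vusc unfolding usc_on_dist by blast
    show "\<exists>d>0. \<forall>x\<in>?S \<times> ?S. dist x y < d \<longrightarrow> ?F x < a"
    proof (intro exI[of _ "min d1 (min d2 d3)"] conjI ballI impI)
      fix x assume x: "x \<in> ?S \<times> ?S" "dist x y < min d1 (min d2 d3)"
      have "u (fst x) < u (fst y) + e"
        using x dist_fst_le[of x y] by (intro d1(2)) auto
      moreover have "- v (snd x) < - v (snd y) + e"
        using x dist_snd_le[of x y] by (intro d2(2)) auto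
      moreover have "\<bar>real n * rsq (fst x) (snd x) - real n * rsq (fst y) (snd y)\<bar> < e"
        using x by (intro d3(2)) auto
      ultimately have "?F x < ?F y + 3 * e" by linarith
      then show "?F x < a" using e3 by linarith
    qed (use d1 d2 d3 in auto)
  qed blast
  then obtain Y where Y: "\<And>n. Y n \<in> ?S \<times> ?S" "\<And>n x. x \<in> ?S \<times> ?S \<Longrightarrow>
      u (fst x) - v (snd x) - real n * rsq (fst x) (snd x)
      \<le> u (fst (Y n)) - v (snd (Y n)) - real n * rsq (fst (Y n)) (snd (Y n))"
    by metis
  define P where "P = (\<lambda>n. fst (Y n))"
  define Q where "Q = (\<lambda>n. snd (Y n))"
  have PQ: "P n \<in> ?S" "Q n \<in> ?S" for n using Y(1)[of n] by (auto simp: P_def Q_def)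
  have max: "u x - v y - real n * rsq x y \<le> u (P n) - v (Q n) - real n * rsq (P n) (Q n)"
    if "x \<in> ?S" "y \<in> ?S" for x y n
    using Y(2)[of "(x, y)" n] that by (simp add: P_def Q_def)
  have \<sigma>n: "\<sigma> \<le> u (P n) - v (Q n) - real n * rsq (P n) (Q n)" for n
    using max[OF p1 p1, of n] by (simp add: rsq_self \<sigma>_def)
  have nr: "0 \<le> real n * rsq (P n) (Q n)" for n by (simp add: rsq_nonneg)
  have \<sigma>': "\<sigma> \<le> u (P n) - v (Q n)" for n using \<sigma>n[of n] nr[of n] by linarith
  obtain C where C: "\<And>x. x \<in> ?S \<Longrightarrow> - v x \<le> C"
    by (rule usc_on_attains_max[OF S vusc]) blast
  have rle: "rsq (P n) (Q n) \<le> (K + C) / real n" if "n > 0" for n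
  proof -
    have "real n * rsq (P n) (Q n) \<le> K + C"
      using \<sigma>n[of n] \<sigma> u(3)[OF PQ(1)[of n]] C[OF PQ(2)[of n]] by linarith
    then show ?thesis using that by (simp add: field_simps)
  qed
  obtain p r1 where r1: "p \<in> ?S" "strict_mono r1" "(\<lambda>n. P (r1 n)) \<longlonglongrightarrow> p"
    by (rule bounded_convergent_subseq[OF bd PQ(1)])
  obtain q r2 where r2: "q \<in> ?S" "strict_mono r2" "(\<lambda>n. Q (r1 (r2 n))) \<longlonglongrightarrow> q"
    by (rule bounded_convergent_subseq[OF bd, of "\<lambda>n. Q (r1 n)"]) (rule PQ(2))
  define r where "r = (\<lambda>n. r1 (r2 n))"
  have mono: "strict_mono r" using r1(2) r2(2) by (auto simp: r_def strict_mono_def)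
  have rtop: "filterlim r at_top sequentially"
    using mono by (rule filterlim_subseq)
  have Pp: "(\<lambda>n. P (r n)) \<longlonglongrightarrow> p"
    using LIMSEQ_subseq_LIMSEQ[OF r1(3) r2(2)] by (simp add: r_def comp_def)
  have Qq: "(\<lambda>n. Q (r n)) \<longlonglongrightarrow> q" using r2(3) by (simp add: r_def)
  have r0: "\<forall>\<^sub>F n in sequentially. r n > 0"
    using eventually_compose_filterlim[OF eventually_gt_at_top rtop] .
  have lim: "(\<lambda>n. rsq (P (r n)) (Q (r n))) \<longlonglongrightarrow> rsq p q"
    by (intro tendsto_intros Pp Qq)
  have "(\<lambda>n. (K + C) / real (r n)) \<longlonglongrightarrow> 0"
    by (rule filterlim_compose[OF lim_const_over_n rtop])
  then have "rsq p q \<le> 0"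
    by (rule tendsto_le[OF sequentially_bot _ lim]) (use r0 in eventually_elim, simp add: rle)
  then have qp: "q = p" using rsq_nonneg[of p q] rsq_eq_0[of p q] by simp
  with Qq have Qp: "(\<lambda>n. Q (r n)) \<longlonglongrightarrow> p" by simp
  \<comment> \<open>Semicontinuity bounds the limit of u - v from above, which is the direction
    required. On the frontier u is at most K and v at least K, so a positive gap places p in
    \<open>\<Omega>\<close>.\<close>
  have "\<sigma> \<le> u p - v p"
  proof (rule ccontr)
    assume neg: "\<not> ?thesis"
    define e where "e = (\<sigma> - (u p - v p)) / 2"
    have e: "e > 0" using neg by (simp add: e_def)
    have "\<forall>\<^sub>F n in sequentially. u (P (r n)) < u p + e"
      by (rule usc_on_eventually[OF u(1) r1(1) Pp]) (use e PQ in auto)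
    moreover have "\<forall>\<^sub>F n in sequentially. v p - e < v (Q (r n))"
      by (rule lsc_on_eventually[OF v(1) r1(1) Qp]) (use e PQ in auto)
    ultimately have "\<forall>\<^sub>F n in sequentially. False"
    proof eventually_elim
      case (elim n)
      then show False using \<sigma>'[of "r n"] by (simp add: e_def field_simps)
    qed
    then show False by simp
  qed
  with \<sigma> u(3)[OF r1(1)] v(3)[of p] S\<Omega>[OF r1(1)] have p: "p \<in> \<Omega>" by fastforce
  have PE: "\<forall>\<^sub>F n in sequentially. P (r n) \<in> \<Omega>"
    using Pp op p by (rule topological_tendstoD)
  have QE: "\<forall>\<^sub>F n in sequentially. Q (r n) \<in> \<Omega>"
    using Qp op p by (rule topological_tendstoD)
  \<comment> \<open>As a function of the second variable the test function for v is -n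
    \<open>rsq\<close> (., P n); the antisymmetry of \<open>rsq_grad\<close> removes the sign. If
    \<open>Q n\<close> is not in \<open>\<Omega>\<close>, the point \<open>Q n\<close> is a dummy
    that keeps the sequence total, ready for a subsequence.\<close>
  have "\<exists>\<eta>. \<eta> \<in> ?S \<and> (Q n \<in> \<Omega> \<longrightarrow> \<eta> \<in> sublevel_le \<Omega> v (Q n) \<and>
      f (Q n) - \<sigma> / 2 < v (Q n) + (real n *\<^sub>R rsq_grad (P n) (Q n)) \<bullet> horiz (hmul (hinv (Q n)) \<eta>))" for n
  proof (cases "Q n \<in> \<Omega>")
    case True
    have "v (Q n) - - real n * rsq (Q n) (P n) \<le> v y - - real n * rsq y (P n)" if "y \<in> \<Omega>" for y
      using max[OF PQ(1) \<Omega>S[OF that], of n n]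
      unfolding rsq_commute[of y] rsq_commute[of "Q n"] by simp
    from supersolution_test[OF v(2) True C1_on_rsq this, of "\<sigma> / 2"] \<sigma>
    obtain \<eta> where "\<eta> \<in> sublevel_le \<Omega> v (Q n)" "f (Q n) - \<sigma> / 2
        < v (Q n) + hgrad (\<lambda>y. - real n * rsq y (P n)) (Q n) \<bullet> horiz (hmul (hinv (Q n)) \<eta>)"
      by auto
    then show ?thesis
      unfolding hgrad_rsq rsq_grad_commute[of "Q n"] by (intro exI[of _ \<eta>]) (simp add: sublevel_le_def \<Omega>S)
  qed (use PQ in blast)
  then obtain E where ES: "\<And>n. E n \<in> ?S" and E: "\<And>n. Q n \<in> \<Omega> \<Longrightarrow> E n \<in> sublevel_le \<Omega> v (Q n)"
      "\<And>n. Q n \<in> \<Omega> \<Longrightarrow> f (Q n) - \<sigma> / 2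
        < v (Q n) + (real n *\<^sub>R rsq_grad (P n) (Q n)) \<bullet> horiz (hmul (hinv (Q n)) (E n))"
    by metis
  obtain \<eta> k where k: "\<eta> \<in> ?S" "strict_mono k" "(\<lambda>n. E (r (k n))) \<longlonglongrightarrow> \<eta>"
    by (rule bounded_convergent_subseq[OF bd, of "\<lambda>n. E (r n)"]) (rule ES)
  have ktop: "filterlim k at_top sequentially"
    using k(2) by (rule filterlim_subseq)
  have QE': "\<forall>\<^sub>F n in sequentially. Q (r (k n)) \<in> \<Omega>"
    and PE': "\<forall>\<^sub>F n in sequentially. P (r (k n)) \<in> \<Omega>"
    using QE PE ktop by (auto intro: eventually_compose_filterlim)
  have Pk: "(\<lambda>n. P (r (k n))) \<longlonglongrightarrow> p" and Qk: "(\<lambda>n. Q (r (k n))) \<longlonglongrightarrow> p"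
    using LIMSEQ_subseq_LIMSEQ[OF Pp k(2)] LIMSEQ_subseq_LIMSEQ[OF Qp k(2)] by (simp_all add: comp_def)
  \<comment> \<open>Along the sequence v (E) is at most v (Q), hence at most u (P) -
    \<open>\<sigma>\<close> and so at most K - \<open>\<sigma>\<close>; lower semicontinuity keeps
    this in the limit, which therefore is not on the frontier.\<close>
  have "v \<eta> \<le> K - \<sigma>"
  proof (rule ccontr)
    assume "\<not> ?thesis"
    then have "\<forall>\<^sub>F n in sequentially. K - \<sigma> < v (E (r (k n)))"
      by (intro lsc_on_eventually[OF v(1) k(1,3)]) (use ES in auto)
    then have "\<forall>\<^sub>F n in sequentially. False"
      using QE'
    proof eventually_elim
      case (elim n)
      then show False
        using E(1)[OF elim(2)] \<sigma>'[of "r (k n)"] u(3)[OF PQ(1)[of "r (k n)"]]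
        by (simp add: sublevel_le_def)
    qed
    then show False by simp
  qed
  with \<sigma> v(3)[of \<eta>] S\<Omega>[OF k(1)] have \<eta>: "\<eta> \<in> \<Omega>" by fastforce
  \<comment> \<open>The transported points P Q^-1 E have the same limit as E, because P and Q share
    theirs; openness then puts them in \<open>\<Omega>\<close>.\<close>
  have "(\<lambda>n. hmul (P (r (k n))) (hmul (hinv (Q (r (k n)))) (E (r (k n))))) \<longlonglongrightarrow> hmul p (hmul (hinv p) \<eta>)"
    by (intro tendsto_intros Pk Qk k(3))
  then have \<xi>: "\<forall>\<^sub>F n in sequentially. hmul (P (r (k n))) (hmul (hinv (Q (r (k n)))) (E (r (k n)))) \<in> \<Omega>"
    using op \<eta> by (intro topological_tendstoD) (auto simp: hmul_hinv_cancel)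
  have "(\<lambda>n. f (P (r (k n))) - f (Q (r (k n)))) \<longlonglongrightarrow> f p - f p"
    by (intro tendsto_diff continuous_on_tendsto_compose[OF cf] Pk Qk PE' QE' p)
  then have "\<forall>\<^sub>F n in sequentially. f (P (r (k n))) - f (Q (r (k n))) < \<sigma> / 2"
    by (rule order_tendstoD(2)) (use \<sigma> in simp)
  with \<xi> PE' QE' have "\<forall>\<^sub>F n in sequentially. False"
  proof eventually_elim
    case (elim j)
    define n where "n = r (k j)"
    note elim = elim[folded n_def]
    obtain a b where ab: "E n = hmul (Q n) (a, b, 0)" "horiz (hmul (hinv (Q n)) (E n)) = (a, b)"
      using E(1)[OF elim(3)] horizontal_planeE unfolding sublevel_le_def by blast
    have vE: "v (E n) \<le> v (Q n)" using E(1)[OF elim(3)] by (simp add: sublevel_le_def)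
    define M where "M = real n * (rsq_grad (P n) (Q n) \<bullet> (a, b))"
    have fQ: "f (Q n) - \<sigma> / 2 < v (Q n) + M"
      using E(2)[OF elim(3)] unfolding ab(2) by (simp add: M_def)
    have maxP: "u x - real n * rsq x (Q n) \<le> u (P n) - real n * rsq (P n) (Q n)" if "x \<in> \<Omega>" for x
      using max[OF \<Omega>S[OF that] PQ(2), of n n] by simp
    \<comment> \<open>If M is not positive, the bound of u by f suffices. If it is positive, the
      segment argument applies with s = 1, starting from the transported point.\<close>
    have "u (P n) + M \<le> f (P n)"
    proof (cases "M > 0")
      case False
      then show ?thesis
        using subsolution_le_rsq[OF u(2) elim(2) op maxP] by simp
    next
      case True
      have \<xi>0: "hmul (P n) (a, b, 0) \<in> \<Omega>"
        using elim(1) unfolding ab(1) hinv_hmul_cancel .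
      have "((\<lambda>t. hmul (P n) ((1 - t) * a, (1 - t) * b, 0))
          \<longlongrightarrow> hmul (P n) ((1 - 0) * a, (1 - 0) * b, 0)) (at_right 0)"
        by (intro tendsto_intros)
      then have ev: "\<forall>\<^sub>F t in at_right 0. hmul (P n) ((1 - t) * a, (1 - t) * b, 0) \<in> \<Omega>"
        by (rule topological_tendstoD[OF _ op]) (use \<xi>0 in simp)
      have "u (P n) + 1 * (real n * (rsq_grad (P n) (Q n) \<bullet> (a, b))) \<le> f (P n)"
      proof (rule subsolution_segment[OF u(2) elim(2) maxP True[unfolded M_def] ev])
        fix t :: real assume x: "hmul (P n) ((1 - t) * a, (1 - t) * b, 0) \<in> \<Omega>"
        \<comment> \<open>The doubled maximum is compared with the pair formed by this point and
          \<open>E n\<close>; the terms in v are discarded by \<open>vE\<close>.\<close>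
        show "u (hmul (P n) ((1 - t) * a, (1 - t) * b, 0))
          \<le> u (P n) + real n * (rsq (hmul (P n) (- t * a, - t * b, 0)) (Q n) - rsq (P n) (Q n))"
          using max[OF \<Omega>S[OF x] ES[of n], of n] vE
          unfolding ab(1) rsq_hmul_segment by (simp add: right_diff_distrib)
      qed
      then show ?thesis by (simp add: M_def)
    qed
    \<comment> \<open>M cancels: u (P) - v (Q) is below f (P) - f (Q) + \<open>\<sigma>\<close> / 2,
      hence below \<open>\<sigma>\<close>.\<close>
    with fQ \<sigma>'[of n] elim(4) show False by linarith
  qed
  then show False by simp
qed

section \<open>Perron's method\<close>

text \<open>Stability of subsolutions: a test function for w, made strict, is touched by members of
  F at points converging to p, with values whose lower bounds tend to w p.\<close>

lemma subsolution_usc_sup: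
  assumes op: "open \<Omega>" and cf: "continuous_on \<Omega> f"
    and lb: "locally_bounded_on \<Omega> f" "locally_bounded_on \<Omega> w" and usc: "usc_on \<Omega> w"
    and F: "\<And>u. u \<in> F \<Longrightarrow> subsolution \<Omega> f u" "\<And>u x. u \<in> F \<Longrightarrow> x \<in> \<Omega> \<Longrightarrow> u x \<le> w x"
      "\<And>u x. u \<in> F \<Longrightarrow> x \<in> \<Omega> \<Longrightarrow> u x \<le> f x"
    and approx: "\<And>p d c. p \<in> \<Omega> \<Longrightarrow> d > 0 \<Longrightarrow> c < w p \<Longrightarrow> \<exists>u\<in>F. \<exists>x\<in>\<Omega>. dist x p < d \<and> c < u x"
  shows "subsolution \<Omega> f w"
  unfolding subsolution_def
proof (intro conjI ballI allI impI)
  show "usc_on \<Omega> f" using cf by (rule continuous_on_imp_usc_on)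
  fix p \<phi> assume p: "p \<in> \<Omega>" and "C1_on \<Omega> \<phi> \<and> (\<forall>q\<in>\<Omega>. w q - \<phi> q \<le> w p - \<phi> p)"
  then have C1: "C1_on \<Omega> \<phi>" and max: "\<And>q. q \<in> \<Omega> \<Longrightarrow> w q - \<phi> q \<le> w p - \<phi> p" by blast+
  \<comment> \<open>The definition tests only maxima over all of \<open>\<Omega>\<close>. The
    quadratic term lowers w - \<open>\<psi>\<close> by at least \<open>\<rho>\<^sup>2\<close>
    outside the ball, so that a maximum over the ball is a global one.\<close>
  define \<psi> where "\<psi> = (\<lambda>q. \<phi> q + (1 * ((q - p) \<bullet> (q - p)) + 0))"
  have C1': "C1_on \<Omega> \<psi>" unfolding \<psi>_def by (intro C1_on_add C1 C1_on_sqdist)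
  have h\<psi>: "hgrad \<psi> p = hgrad \<phi> p" unfolding \<psi>_def by (rule hgrad_add_sqdist[OF C1 p])
  have \<psi>\<phi>: "\<psi> q = \<phi> q + (dist q p)\<^sup>2" for q
    by (simp add: \<psi>_def dist_norm power2_norm_eq_inner)
  obtain r0 where r0: "r0 > 0" "cball p r0 \<subseteq> \<Omega>" using op p open_contains_cball by blast
  have ex: "\<exists>u y. u \<in> F \<and> y \<in> cball p \<rho> \<and> (\<forall>q\<in>\<Omega>. u q - \<psi> q \<le> u y - \<psi> y) \<and> \<phi> y - \<phi> p + w p - \<rho>\<^sup>2 \<le> u y"
    if \<rho>: "0 < \<rho>" "\<rho> \<le> r0" for \<rho>
  proof -
    have sub: "cball p \<rho> \<subseteq> \<Omega>" using r0(2) \<rho>(2) by auto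
    \<comment> \<open>Two errors of \<open>\<rho>\<^sup>2 / 2\<close>, one in \<open>\<psi>\<close>
      and one in the value of u, stay together below that margin.\<close>
    have "usc_on \<Omega> \<psi>" using C1' by (intro continuous_on_imp_usc_on C1_on_continuous)
    then obtain d where d: "d > 0" "\<And>q. q \<in> \<Omega> \<Longrightarrow> dist q p < d \<Longrightarrow> \<psi> q < \<psi> p + \<rho>\<^sup>2 / 2"
      using p \<rho>(1) unfolding usc_on_dist by (metis half_gt_zero less_add_same_cancel1 zero_less_power)
    obtain u x where u: "u \<in> F" and x: "x \<in> \<Omega>" "dist x p < min d \<rho>" "w p - \<rho>\<^sup>2 / 2 < u x"
      using approx[OF p, of "min d \<rho>" "w p - \<rho>\<^sup>2 / 2"] d(1) \<rho>(1) by auto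
    have xb: "x \<in> cball p \<rho>" using x(2) by (simp add: dist_commute)
    have "usc_on \<Omega> u" using F(1)[OF u] by (simp add: subsolution_def)
    then have "usc_on (cball p \<rho>) (\<lambda>q. u q - \<psi> q)"
      by (rule usc_on_diff_continuous[OF usc_on_subset[OF _ sub]
            continuous_on_subset[OF C1_on_continuous[OF C1'] sub]])
    then obtain y where y: "y \<in> cball p \<rho>" "\<And>q. q \<in> cball p \<rho> \<Longrightarrow> u q - \<psi> q \<le> u y - \<psi> y"
      by (rule usc_on_attains_max[OF compact_cball, rotated 1]) (use xb in blast)+
    have "\<psi> p = \<phi> p" by (simp add: \<psi>\<phi>)
    then have big: "w p - \<phi> p - \<rho>\<^sup>2 < u y - \<psi> y"
      using d(2)[OF x(1)] x(2,3) y(2)[OF xb] by auto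
    have "u q - \<psi> q \<le> u y - \<psi> y" if q: "q \<in> \<Omega>" for q
    proof (cases "q \<in> cball p \<rho>")
      case False
      then have "\<rho> \<le> dist q p" by (simp add: dist_commute)
      then have "\<rho>\<^sup>2 \<le> (dist q p)\<^sup>2" using \<rho>(1) by (intro power_mono) auto
      then show ?thesis using big max[OF q] F(2)[OF u q] by (simp add: \<psi>\<phi>)
    qed (rule y(2))
    moreover have "\<phi> y - \<phi> p + w p - \<rho>\<^sup>2 \<le> u y"
      using big zero_le_power2[of "dist y p"] unfolding \<psi>\<phi> by linarith
    ultimately show ?thesis using u y(1) by blast
  qed
  define \<rho> where "\<rho> = (\<lambda>n. r0 * inverse (real (Suc n)))"
  have \<rho>: "0 < \<rho> n" "\<rho> n \<le> r0" for n using r0(1) by (simp_all add: \<rho>_def field_simps)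
  have \<rho>0: "\<rho> \<longlonglongrightarrow> 0"
    unfolding \<rho>_def using tendsto_mult[OF tendsto_const LIMSEQ_inverse_real_of_nat, of r0] by simp
  obtain U Y where UF: "\<And>n. U n \<in> F" and Y: "\<And>n. Y n \<in> cball p (\<rho> n)"
    and UY: "\<And>n q. q \<in> \<Omega> \<Longrightarrow> U n q - \<psi> q \<le> U n (Y n) - \<psi> (Y n)"
    and lo: "\<And>n. \<phi> (Y n) - \<phi> p + w p - (\<rho> n)\<^sup>2 \<le> U n (Y n)"
    using ex[OF \<rho>] by metis
  have Y\<Omega>: "Y n \<in> \<Omega>" for n using Y[of n] \<rho>(2)[of n] r0(2) by (meson mem_cball order_trans subsetD)
  have Yp: "Y \<longlonglongrightarrow> p"
    unfolding tendsto_dist_iff[of Y]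
    by (rule tendsto_sandwich[OF _ _ tendsto_const \<rho>0]) (use Y in \<open>auto simp: dist_commute\<close>)
  have Yev: "\<forall>\<^sub>F n in sequentially. Y n \<in> \<Omega>" using Y\<Omega> by simp
  have "(\<lambda>n. \<phi> (Y n) - \<phi> p + w p - (\<rho> n)\<^sup>2) \<longlonglongrightarrow> \<phi> p - \<phi> p + w p - 0\<^sup>2"
    by (intro tendsto_intros \<rho>0 continuous_on_tendsto_compose[OF C1_on_continuous[OF C1] Yp p Yev])
  then have lolim: "(\<lambda>n. \<phi> (Y n) - \<phi> p + w p - (\<rho> n)\<^sup>2) \<longlonglongrightarrow> w p" by simp
  have flim: "(\<lambda>n. f (Y n)) \<longlonglongrightarrow> f p"
    by (rule continuous_on_tendsto_compose[OF cf Yp p Yev])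
  have hlim: "(\<lambda>n. hgrad \<psi> (Y n)) \<longlonglongrightarrow> hgrad \<phi> p"
    unfolding h\<psi>[symmetric]
    by (rule continuous_on_tendsto_compose[OF continuous_on_hgrad[OF C1'] Yp p Yev])
  show "ereal (w p) + (if hgrad \<phi> p = 0 then 0 else
      SUP \<xi>\<in>sublevel \<Omega> w p. ereal (hgrad \<phi> p \<bullet> horiz (hmul (hinv p) \<xi>))) \<le> ereal (f p)"
  proof (cases "hgrad \<phi> p = 0")
    case True
    \<comment> \<open>Gradients at \<open>Y n\<close> may be nonzero although they tend to 0, so the
      bound of the family by f is used here instead of the test.\<close>
    have "w p \<le> f p"
      by (rule tendsto_le[OF sequentially_bot flim lolim])
        (intro always_eventually allI order_trans[OF lo F(3)[OF UF Y\<Omega>]])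
    with True show ?thesis by simp
  next
    case False
    have "w p + hgrad \<phi> p \<bullet> horiz (hmul (hinv p) \<xi>) \<le> f p" if \<xi>: "\<xi> \<in> sublevel \<Omega> w p" for \<xi>
    proof -
      obtain a b where ab: "\<xi> = hmul p (a, b, 0)" "horiz (hmul (hinv p) \<xi>) = (a, b)"
        using \<xi> horizontal_planeE unfolding sublevel_def by blast
      have X: "(\<lambda>n. hmul (Y n) (a, b, 0)) \<longlonglongrightarrow> \<xi>"
        unfolding ab(1) by (intro tendsto_intros Yp)
      have \<xi>\<Omega>: "\<xi> \<in> \<Omega>" "w \<xi> < w p" using \<xi> by (auto simp: sublevel_def)
      \<comment> \<open>The strict inequality at \<open>\<xi>\<close> leaves room for c, which
        separates the values at the translates of \<open>\<xi>\<close> from those at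
        \<open>Y n\<close>; hence the translates lie in the strict sublevel sets of
        \<open>U n\<close>.\<close>
      obtain c where c: "w \<xi> < c" "c < w p" using dense[OF \<xi>\<Omega>(2)] by blast
      have X\<Omega>: "\<forall>\<^sub>F n in sequentially. hmul (Y n) (a, b, 0) \<in> \<Omega>"
        using X op \<xi>\<Omega>(1) by (rule topological_tendstoD)
      have "\<forall>\<^sub>F n in sequentially. w (hmul (Y n) (a, b, 0)) < c"
        by (rule usc_on_eventually[OF usc \<xi>\<Omega>(1) X X\<Omega> c(1)])
      moreover have "\<forall>\<^sub>F n in sequentially. c < \<phi> (Y n) - \<phi> p + w p - (\<rho> n)\<^sup>2"
        using lolim c(2) by (rule order_tendstoD(1))
      moreover have "\<forall>\<^sub>F n in sequentially. hgrad \<psi> (Y n) \<noteq> 0"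
        using hlim False by (rule tendsto_imp_eventually_ne)
      ultimately have "\<forall>\<^sub>F n in sequentially.
          \<phi> (Y n) - \<phi> p + w p - (\<rho> n)\<^sup>2 + hgrad \<psi> (Y n) \<bullet> (a, b) \<le> f (Y n)"
        using X\<Omega>
      proof eventually_elim
        case (elim n)
        have "hmul (Y n) (a, b, 0) \<in> sublevel \<Omega> (U n) (Y n)"
          using elim lo[of n] F(2)[OF UF[of n] elim(4)]
          by (simp add: sublevel_def hmul_in_horizontal_plane)
        from subsolution_test[OF F(1)[OF UF] Y\<Omega> C1' UY elim(3) this] lo[of n]
        show ?case by (simp add: hinv_hmul_cancel horiz_eq)
      qed
      moreover have "(\<lambda>n. \<phi> (Y n) - \<phi> p + w p - (\<rho> n)\<^sup>2 + hgrad \<psi> (Y n) \<bullet> (a, b))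
          \<longlonglongrightarrow> w p + hgrad \<phi> p \<bullet> (a, b)"
        by (intro tendsto_add tendsto_inner lolim hlim tendsto_const)
      ultimately show ?thesis
        unfolding ab(2) by (intro tendsto_le[OF sequentially_bot flim])
    qed
    then have "(SUP \<xi>\<in>sublevel \<Omega> w p. ereal (hgrad \<phi> p \<bullet> horiz (hmul (hinv p) \<xi>))) \<le> ereal (f p - w p)"
      by (intro SUP_least) (simp add: le_diff_eq add.commute)
    then have "ereal (w p) + (SUP \<xi>\<in>sublevel \<Omega> w p. ereal (hgrad \<phi> p \<bullet> horiz (hmul (hinv p) \<xi>)))
        \<le> ereal (w p) + ereal (f p - w p)"
      by (rule add_left_mono)
    with False show ?thesis by simp
  qed
qed (use lb usc in auto)

section \<open>The bump argument and the supersolution property\<close>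

lemma hgrad_eq_at_max:
  assumes "open \<Omega>" "p \<in> \<Omega>" "C1_on \<Omega> \<phi>" "C1_on \<Omega> \<psi>"
    and "\<And>q. q \<in> \<Omega> \<Longrightarrow> \<phi> q - \<psi> q \<le> \<phi> p - \<psi> p"
  shows "hgrad \<psi> p = hgrad \<phi> p"
proof -
  let ?D = "\<lambda>v. frechet_derivative \<phi> (at p) v - frechet_derivative \<psi> (at p) v"
  have "((\<lambda>q. \<phi> q - \<psi> q) has_derivative ?D) (at p)"
    by (intro has_derivative_diff C1_on_has_derivative[OF _ assms(2)] assms)
  then have "?D = (\<lambda>v. 0)"
    using differential_zero_maxmin[OF assms(2,1), of "\<lambda>q. \<phi> q - \<psi> q" ?D] assms(5) by blast
  then have "frechet_derivative \<phi> (at p) = frechet_derivative \<psi> (at p)"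
    by (metis (no_types, lifting) ext eq_iff_diff_eq_0)
  then show ?thesis
    using hgrad_eq[OF C1_on_has_derivative[OF assms(3,2)]] hgrad_eq[OF C1_on_has_derivative[OF assms(4,2)]]
    by simp
qed

text \<open>Since \<open>\<phi>\<close> lies below v with a quadratic margin, lifting it by
  \<open>\<delta>\<close> changes w only within distance sqrt \<open>\<delta>\<close> of p0. The
  maximum u of the two exceeds w somewhere, so maximality prevents it from being a subsolution, and
  the point where its test fails supplies p and \<open>\<xi>\<close>.\<close>

lemma maximal_subsolution_bump:
  assumes op: "open \<Omega>" and bd: "bounded \<Omega>"
    and w: "usc_on (closure \<Omega>) w" "subsolution \<Omega> f w" "\<And>x. x \<in> \<Omega> \<Longrightarrow> b \<le> w x"
    and maximal: "\<forall>u. usc_on (closure \<Omega>) u \<and> subsolution \<Omega> f u \<and>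
      (\<forall>y\<in>frontier \<Omega>. u y = w y) \<longrightarrow> (\<forall>x\<in>\<Omega>. u x \<le> w x)"
    and v: "\<And>x. x \<in> \<Omega> \<Longrightarrow> v x \<le> w x"
      "\<And>p d c. p \<in> \<Omega> \<Longrightarrow> d > 0 \<Longrightarrow> v p < c \<Longrightarrow> \<exists>x\<in>\<Omega>. dist x p < d \<and> w x < c"
    and p0: "p0 \<in> \<Omega>" and C1: "C1_on \<Omega> \<phi>" and \<phi>p0: "\<phi> p0 = v p0"
    and \<phi>v: "\<And>q. q \<in> \<Omega> \<Longrightarrow> \<phi> q + (dist q p0)\<^sup>2 \<le> v q"
    and r0: "r0 > 0" "ball p0 r0 \<subseteq> \<Omega>" and \<delta>: "0 < \<delta>" "\<delta> < r0\<^sup>2"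
  obtains p \<xi> where "p \<in> \<Omega>" "(dist p p0)\<^sup>2 < \<delta>" "\<xi> \<in> horizontal_plane p \<inter> \<Omega>"
    "v \<xi> \<le> \<phi> p + \<delta>" "f p < \<phi> p + \<delta> + hgrad \<phi> p \<bullet> horiz (hmul (hinv p) \<xi>)"
proof -
  let ?S = "closure \<Omega>"
  define u where "u = (\<lambda>x. if x \<in> \<Omega> then max (w x) (\<phi> x + \<delta>) else w x)"
  have uw: "w x \<le> u x" for x by (simp add: u_def)
  have u_out: "u x = w x" if "\<delta> \<le> (dist x p0)\<^sup>2" for x
    using that \<phi>v[of x] v(1)[of x] by (auto simp: u_def)
  have c\<phi>: "continuous_on \<Omega> \<phi>" by (rule C1_on_continuous[OF C1])
  have usc: "usc_on ?S u"
    unfolding usc_on_dist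
  proof (intro ballI allI impI)
    fix p a assume p: "p \<in> ?S" and a: "u p < a"
    have "w p < a" using uw[of p] a by simp
    then obtain d1 where d1: "d1 > 0" "\<And>q. q \<in> ?S \<Longrightarrow> dist q p < d1 \<Longrightarrow> w q < a"
      using w(1) p unfolding usc_on_dist by blast
    show "\<exists>d>0. \<forall>q\<in>?S. dist q p < d \<longrightarrow> u q < a"
    proof (cases "p \<in> \<Omega>")
      case True
      then have "\<phi> p < a - \<delta>" using a by (simp add: u_def)
      then obtain d2 where d2: "d2 > 0" "\<And>q. q \<in> \<Omega> \<Longrightarrow> dist q p < d2 \<Longrightarrow> \<phi> q < a - \<delta>"
        using continuous_on_imp_usc_on[OF c\<phi>] True unfolding usc_on_dist by blast
      show ?thesis
      proof (intro exI[of _ "min d1 d2"] conjI ballI impI)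
        fix q assume q: "q \<in> ?S" "dist q p < min d1 d2"
        show "u q < a" using d1(2)[OF q(1)] d2(2)[of q] q(2) by (auto simp: u_def)
      qed (use d1 d2 in simp)
    next
      case False
      then have "p \<notin> ball p0 r0" using r0(2) by blast
      then have far: "r0 \<le> dist p p0" by (simp add: dist_commute)
      \<comment> \<open>The lifted region keeps a positive distance from the complement of
        \<open>\<Omega>\<close>; near p therefore u agrees with w.\<close>
      have "sqrt \<delta> < r0" using \<delta>(2) r0(1) by (simp add: real_less_lsqrt)
      show ?thesis
      proof (intro exI[of _ "min d1 (r0 - sqrt \<delta>)"] conjI ballI impI)
        fix q assume q: "q \<in> ?S" "dist q p < min d1 (r0 - sqrt \<delta>)"
        have "sqrt \<delta> \<le> dist q p0"
          using far q(2) dist_triangle[of p p0 q] by (simp add: dist_commute)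
        then have "\<delta> \<le> (dist q p0)\<^sup>2" by (rule sqrt_le_D)
        then show "u q < a" using d1(2)[OF q(1)] q(2) by (simp add: u_out)
      qed (use d1 \<open>sqrt \<delta> < r0\<close> in simp)
    qed
  qed
  have "\<not> subsolution \<Omega> f u"
  proof
    assume "subsolution \<Omega> f u"
    moreover have "\<forall>y\<in>frontier \<Omega>. u y = w y"
      using op by (simp add: u_def frontier_def interior_open)
    ultimately have le: "u x \<le> w x" if "x \<in> \<Omega>" for x
      using that usc maximal by blast
    \<comment> \<open>Near p0 the lifted function is above v p0 + \<open>\<delta>\<close> / 2, while
      w falls below this number at some nearby point.\<close>
    have "v p0 - \<delta> / 2 < \<phi> p0" using \<phi>p0 \<delta>(1) by simp
    then have "- \<phi> p0 < - (v p0 - \<delta> / 2)" by simp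
    then obtain d where d: "d > 0" "\<And>q. q \<in> \<Omega> \<Longrightarrow> dist q p0 < d \<Longrightarrow> - \<phi> q < - (v p0 - \<delta> / 2)"
      using continuous_on_imp_lsc_on[OF c\<phi>] p0 unfolding lsc_on_uminus usc_on_dist by blast
    obtain x where x: "x \<in> \<Omega>" "dist x p0 < d" "w x < v p0 + \<delta> / 2"
      using v(2)[OF p0 d(1), of "v p0 + \<delta> / 2"] \<delta>(1) by auto
    show False using le[OF x(1)] d(2)[OF x(1,2)] x by (simp add: u_def)
  qed
  moreover have "locally_bounded_on \<Omega> u"
  proof (cases "\<Omega> = {}")
    case False
    then have "compact ?S" "?S \<noteq> {}" using bd by simp_all
    then obtain B where B: "\<And>x. x \<in> ?S \<Longrightarrow> u x \<le> B"
      by (rule usc_on_attains_max[OF _ _ usc]) blast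
    show ?thesis
    proof (rule locally_bounded_on_bounded)
      show "b \<le> u p" if "p \<in> \<Omega>" for p using w(3)[OF that] uw[of p] by simp
      show "u p \<le> B" if "p \<in> \<Omega>" for p using B that closure_subset by blast
    qed
  qed (simp add: locally_bounded_on_def)
  moreover have "usc_on \<Omega> u" using usc closure_subset by (rule usc_on_subset)
  moreover have "usc_on \<Omega> f" "locally_bounded_on \<Omega> f" using w(2) by (simp_all add: subsolution_def)
  ultimately obtain p \<psi> where p: "p \<in> \<Omega>" and C1': "C1_on \<Omega> \<psi>"
    and max: "\<And>q. q \<in> \<Omega> \<Longrightarrow> u q - \<psi> q \<le> u p - \<psi> p"
    and fail: "\<not> ereal (u p) + (if hgrad \<psi> p = 0 then 0 else
        (SUP \<xi>\<in>sublevel \<Omega> u p. ereal (hgrad \<psi> p \<bullet> horiz (hmul (hinv p) \<xi>)))) \<le> ereal (f p)"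
    unfolding subsolution_def by blast
  \<comment> \<open>If u and w agreed at p, the same test function would touch w there, and the
    sublevel set of u is the smaller one, so the failure would contradict the subsolution property
    of w.\<close>
  have "u p \<noteq> w p"
  proof
    assume eq: "u p = w p"
    have "w q - \<psi> q \<le> w p - \<psi> p" if "q \<in> \<Omega>" for q
      using max[OF that] uw[of q] eq by linarith
    then have *: "ereal (w p) + (if hgrad \<psi> p = 0 then 0 else
        (SUP \<xi>\<in>sublevel \<Omega> w p. ereal (hgrad \<psi> p \<bullet> horiz (hmul (hinv p) \<xi>)))) \<le> ereal (f p)"
      using w(2) p C1' unfolding subsolution_def by blast
    have "sublevel \<Omega> u p \<subseteq> sublevel \<Omega> w p"
      unfolding sublevel_def eq using uw by (auto intro: le_less_trans)
    then have "ereal (w p) + (if hgrad \<psi> p = 0 then 0 else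
        (SUP \<xi>\<in>sublevel \<Omega> u p. ereal (hgrad \<psi> p \<bullet> horiz (hmul (hinv p) \<xi>))))
      \<le> ereal (w p) + (if hgrad \<psi> p = 0 then 0 else
        (SUP \<xi>\<in>sublevel \<Omega> w p. ereal (hgrad \<psi> p \<bullet> horiz (hmul (hinv p) \<xi>))))"
      by (intro add_left_mono) (auto intro: SUP_subset_mono)
    with * fail show False unfolding eq by (meson order_trans)
  qed
  then have up: "u p = \<phi> p + \<delta>" "w p < \<phi> p + \<delta>" using p by (auto simp: u_def max_def split: if_splits)
  have near: "(dist p p0)\<^sup>2 < \<delta>" using up(2) \<phi>v[OF p] v(1)[OF p] by linarith
  \<comment> \<open>The unknown test function touches the lifted \<open>\<phi>\<close> as well, so
    its gradient at p is that of \<open>\<phi>\<close>.\<close>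
  have "\<phi> q - \<psi> q \<le> \<phi> p - \<psi> p" if "q \<in> \<Omega>" for q
    using max[OF that] up(1) that by (auto simp: u_def max_def split: if_splits)
  from hgrad_eq_at_max[OF op p C1 C1' this] have h: "hgrad \<psi> p = hgrad \<phi> p" by simp
  show thesis
  proof (cases "hgrad \<phi> p = 0")
    case True
    \<comment> \<open>With a zero gradient the point p itself serves as \<open>\<xi>\<close>, and
      both cases yield the same conclusion.\<close>
    then have "f p < \<phi> p + \<delta>" using fail unfolding h up(1) by simp
    moreover have "p \<in> horizontal_plane p" "v p \<le> \<phi> p + \<delta>"
      using v(1)[OF p] up(2) by (auto simp: mem_horizontal_plane hmul_hinv)
    ultimately show ?thesis using that[of p p] p near True by simp
  next
    case False
    have "\<exists>\<xi>\<in>sublevel \<Omega> u p. f p < \<phi> p + \<delta> + hgrad \<phi> p \<bullet> horiz (hmul (hinv p) \<xi>)"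
    proof (rule ccontr)
      assume "\<not> ?thesis"
      then have "(SUP \<xi>\<in>sublevel \<Omega> u p. ereal (hgrad \<phi> p \<bullet> horiz (hmul (hinv p) \<xi>)))
          \<le> ereal (f p - (\<phi> p + \<delta>))"
        by (intro SUP_least) (simp add: not_less le_diff_eq add.commute)
      then have "ereal (u p) + (SUP \<xi>\<in>sublevel \<Omega> u p. ereal (hgrad \<phi> p \<bullet> horiz (hmul (hinv p) \<xi>)))
          \<le> ereal (u p) + ereal (f p - (\<phi> p + \<delta>))"
        by (rule add_left_mono)
      with fail False show False unfolding h up(1) by simp
    qed
    then obtain \<xi> where \<xi>: "\<xi> \<in> sublevel \<Omega> u p" "f p < \<phi> p + \<delta> + hgrad \<phi> p \<bullet> horiz (hmul (hinv p) \<xi>)"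
      by blast
    then have "\<xi> \<in> horizontal_plane p \<inter> \<Omega>" "u \<xi> < \<phi> p + \<delta>" by (auto simp: sublevel_def up(1))
    moreover from this have "v \<xi> \<le> \<phi> p + \<delta>" using uw[of \<xi>] v(1)[of \<xi>] by simp
    ultimately show ?thesis using that p near \<xi>(2) by blast
  qed
qed

text \<open>If the test failed at p0, bumps of height tending to 0 would give points p_n tending to
  p0 and \<open>\<xi>\<close>_n whose limit lies in the weak sublevel set and violates the failure.
  The conditions on v fit both the lower envelope of w and, once it is known to be lower
  semicontinuous, w itself.\<close>

lemma maximal_subsolution_imp_supersolution:
  assumes op: "open \<Omega>" and bd: "bounded \<Omega>"
    and cf: "continuous_on \<Omega> f" "\<And>x. x \<in> \<Omega> \<Longrightarrow> f x \<le> K"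
    and w: "usc_on (closure \<Omega>) w" "subsolution \<Omega> f w" "\<And>x. x \<in> \<Omega> \<Longrightarrow> b \<le> w x"
    and maximal: "\<forall>u. usc_on (closure \<Omega>) u \<and> subsolution \<Omega> f u \<and>
      (\<forall>y\<in>frontier \<Omega>. u y = w y) \<longrightarrow> (\<forall>x\<in>\<Omega>. u x \<le> w x)"
    and v: "\<And>x. x \<in> \<Omega> \<Longrightarrow> v x \<le> w x"
      "\<And>p d c. p \<in> \<Omega> \<Longrightarrow> d > 0 \<Longrightarrow> v p < c \<Longrightarrow> \<exists>x\<in>\<Omega>. dist x p < d \<and> w x < c"
      "lsc_on (closure \<Omega>) v" "\<And>x. x \<in> frontier \<Omega> \<Longrightarrow> K \<le> v x" "locally_bounded_on \<Omega> v"
  shows "supersolution \<Omega> f v"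
  unfolding supersolution_def
proof (intro conjI ballI allI impI)
  show "lsc_on \<Omega> f" using cf(1) by (rule continuous_on_imp_lsc_on)
  show "locally_bounded_on \<Omega> f" using w(2) by (simp add: subsolution_def)
  show "lsc_on \<Omega> v" using v(3) closure_subset by (rule lsc_on_subset)
  fix p0 \<phi> assume p0: "p0 \<in> \<Omega>" and "C1_on \<Omega> \<phi> \<and> (\<forall>q\<in>\<Omega>. v p0 - \<phi> p0 \<le> v q - \<phi> q)"
  then have C1: "C1_on \<Omega> \<phi>" and min: "\<And>q. q \<in> \<Omega> \<Longrightarrow> v p0 - \<phi> p0 \<le> v q - \<phi> q" by blast+
  show "ereal (f p0) \<le> ereal (v p0) +
      (SUP \<xi>\<in>sublevel_le \<Omega> v p0. ereal (hgrad \<phi> p0 \<bullet> horiz (hmul (hinv p0) \<xi>)))"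
  proof (rule ccontr)
    assume fail: "\<not> ?thesis"
    have less: "v p0 + hgrad \<phi> p0 \<bullet> horiz (hmul (hinv p0) \<xi>) < f p0" if "\<xi> \<in> sublevel_le \<Omega> v p0" for \<xi>
    proof -
      have "ereal (v p0) + ereal (hgrad \<phi> p0 \<bullet> horiz (hmul (hinv p0) \<xi>)) \<le> ereal (v p0) +
          (SUP \<xi>\<in>sublevel_le \<Omega> v p0. ereal (hgrad \<phi> p0 \<bullet> horiz (hmul (hinv p0) \<xi>)))"
        using that by (intro add_left_mono SUP_upper)
      also have "\<dots> < ereal (f p0)" using fail by simp
      finally show ?thesis by simp
    qed
    \<comment> \<open>The quadratic makes the contact strict, and the constant makes it happen at
      height v p0.\<close>
    define \<psi> where "\<psi> = (\<lambda>q. \<phi> q + (- 1 * ((q - p0) \<bullet> (q - p0)) + (v p0 - \<phi> p0)))"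
    have C1': "C1_on \<Omega> \<psi>" unfolding \<psi>_def by (intro C1_on_add C1 C1_on_sqdist)
    have h\<psi>: "hgrad \<psi> p0 = hgrad \<phi> p0" unfolding \<psi>_def by (rule hgrad_add_sqdist[OF C1 p0])
    have \<psi>\<phi>: "\<psi> q = \<phi> q - (dist q p0)\<^sup>2 + v p0 - \<phi> p0" for q
      by (simp add: \<psi>_def dist_norm power2_norm_eq_inner)
    have \<psi>p0: "\<psi> p0 = v p0" by (simp add: \<psi>\<phi>)
    have \<psi>v: "\<psi> q + (dist q p0)\<^sup>2 \<le> v q" if "q \<in> \<Omega>" for q using min[OF that] by (simp add: \<psi>\<phi>)
    obtain r0 where r0: "r0 > 0" "ball p0 r0 \<subseteq> \<Omega>" using op p0 open_contains_ball by blast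
    \<comment> \<open>The factor 1/2 keeps the bound by \<open>r0\<^sup>2\<close> strict already at
      n = 0.\<close>
    define \<delta> where "\<delta> = (\<lambda>n. r0\<^sup>2 / 2 * inverse (real (Suc n)))"
    have \<delta>: "0 < \<delta> n" "\<delta> n < r0\<^sup>2" for n
    proof -
      show "0 < \<delta> n" using r0(1) by (simp add: \<delta>_def)
      have "\<delta> n \<le> r0\<^sup>2 / 2" using r0(1) by (simp add: \<delta>_def field_simps)
      then show "\<delta> n < r0\<^sup>2" using r0(1) by (smt (verit) field_sum_of_halves zero_less_power)
    qed
    have \<delta>0: "\<delta> \<longlonglongrightarrow> 0"
      unfolding \<delta>_def using tendsto_mult[OF tendsto_const LIMSEQ_inverse_real_of_nat, of "r0\<^sup>2 / 2"] by simp
    have "\<exists>p \<xi>. p \<in> \<Omega> \<and> (dist p p0)\<^sup>2 < \<delta> n \<and> \<xi> \<in> horizontal_plane p \<inter> \<Omega> \<and>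
        v \<xi> \<le> \<psi> p + \<delta> n \<and> f p < \<psi> p + \<delta> n + hgrad \<psi> p \<bullet> horiz (hmul (hinv p) \<xi>)" for n
      using maximal_subsolution_bump[OF op bd w maximal v(1,2) p0 C1' \<psi>p0 \<psi>v r0 \<delta>, of n] by blast
    then obtain P X where P: "\<And>n. P n \<in> \<Omega>" "\<And>n. (dist (P n) p0)\<^sup>2 < \<delta> n"
      and X: "\<And>n. X n \<in> horizontal_plane (P n)" "\<And>n. X n \<in> \<Omega>" "\<And>n. v (X n) \<le> \<psi> (P n) + \<delta> n"
        "\<And>n. f (P n) < \<psi> (P n) + \<delta> n + hgrad \<psi> (P n) \<bullet> horiz (hmul (hinv (P n)) (X n))"
      unfolding Int_iff by metis
    have P0: "P \<longlonglongrightarrow> p0"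
      unfolding tendsto_dist_iff[of P]
    proof (rule tendsto_sandwich[OF _ _ tendsto_const])
      show "(\<lambda>n. sqrt (\<delta> n)) \<longlonglongrightarrow> 0" using tendsto_real_sqrt[OF \<delta>0] by simp
      show "\<forall>\<^sub>F n in sequentially. dist (P n) p0 \<le> sqrt (\<delta> n)"
        using P(2) by (intro always_eventually allI real_le_rsqrt less_imp_le)
    qed simp
    have X\<Omega>: "X n \<in> closure \<Omega>" for n using X(2) closure_subset by blast
    obtain \<xi> r where \<xi>: "\<xi> \<in> closure \<Omega>" "strict_mono r" "(\<lambda>n. X (r n)) \<longlonglongrightarrow> \<xi>"
      by (rule bounded_convergent_subseq[OF bd X\<Omega>])
    have Pr: "(\<lambda>n. P (r n)) \<longlonglongrightarrow> p0" and \<delta>r: "(\<lambda>n. \<delta> (r n)) \<longlonglongrightarrow> 0"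
      using LIMSEQ_subseq_LIMSEQ[OF P0 \<xi>(2)] LIMSEQ_subseq_LIMSEQ[OF \<delta>0 \<xi>(2)] by (simp_all add: comp_def)
    have Pev: "\<forall>\<^sub>F n in sequentially. P (r n) \<in> \<Omega>" using P(1) by simp
    have lim\<psi>: "(\<lambda>n. \<psi> (P (r n)) + \<delta> (r n)) \<longlonglongrightarrow> v p0 + 0"
      unfolding \<psi>p0[symmetric]
      by (intro tendsto_add \<delta>r continuous_on_tendsto_compose[OF C1_on_continuous[OF C1'] Pr p0 Pev])
    have "v \<xi> \<le> v p0"
    proof (rule ccontr)
      assume "\<not> ?thesis"
      then obtain c where c: "v p0 < c" "c < v \<xi>" using dense not_le by metis
      have "\<forall>\<^sub>F n in sequentially. c < v (X (r n))"
        by (rule lsc_on_eventually[OF v(3) \<xi>(1,3) _ c(2)]) (use X\<Omega> in simp)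
      moreover have "\<forall>\<^sub>F n in sequentially. \<psi> (P (r n)) + \<delta> (r n) < c"
        using lim\<psi> c(1) by (intro order_tendstoD(2)) auto
      ultimately have "\<forall>\<^sub>F n in sequentially. False"
        by eventually_elim (use X(3) in \<open>meson less_asym le_less_trans not_less\<close>)
      then show False by simp
    qed
    \<comment> \<open>The point p0 belongs to its own weak sublevel set and pairs to 0. This, with f
      at most K, keeps the limit \<open>\<xi>\<close> off the frontier.\<close>
    moreover have "v p0 < f p0"
      using less[of p0] p0
      by (simp add: sublevel_le_def mem_horizontal_plane hmul_hinv horiz_eq zero_prod_def[symmetric])
    ultimately have "v \<xi> < K" using cf(2)[OF p0] by simp
    then have \<xi>\<Omega>: "\<xi> \<in> \<Omega>"
      using v(4)[of \<xi>] \<xi>(1) op by (force simp: frontier_def interior_open)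
    have hm: "(\<lambda>n. hmul (hinv (P (r n))) (X (r n))) \<longlonglongrightarrow> hmul (hinv p0) \<xi>"
      by (intro tendsto_intros Pr \<xi>(3))
    have "(\<lambda>n. snd (snd (hmul (hinv (P (r n))) (X (r n))))) \<longlonglongrightarrow> snd (snd (hmul (hinv p0) \<xi>))"
      by (intro tendsto_intros hm)
    then have "\<xi> \<in> horizontal_plane p0"
      using X(1) unfolding mem_horizontal_plane by (simp add: LIMSEQ_const_iff)
    with \<xi>\<Omega> \<open>v \<xi> \<le> v p0\<close> have "\<xi> \<in> sublevel_le \<Omega> v p0" by (simp add: sublevel_le_def)
    from less[OF this] have lt: "v p0 + hgrad \<phi> p0 \<bullet> horiz (hmul (hinv p0) \<xi>) < f p0" .
    have "(\<lambda>n. \<psi> (P (r n)) + \<delta> (r n) + hgrad \<psi> (P (r n)) \<bullet> horiz (hmul (hinv (P (r n))) (X (r n))))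
        \<longlonglongrightarrow> v p0 + 0 + hgrad \<psi> p0 \<bullet> horiz (hmul (hinv p0) \<xi>)"
      by (intro tendsto_add tendsto_inner tendsto_horiz lim\<psi> hm
          continuous_on_tendsto_compose[OF continuous_on_hgrad[OF C1'] Pr p0 Pev])
    moreover have "(\<lambda>n. f (P (r n))) \<longlonglongrightarrow> f p0"
      by (rule continuous_on_tendsto_compose[OF cf(1) Pr p0 Pev])
    ultimately have "f p0 \<le> v p0 + 0 + hgrad \<psi> p0 \<bullet> horiz (hmul (hinv p0) \<xi>)"
      by (rule tendsto_le[OF sequentially_bot])
        (use X(4) in \<open>auto intro: less_imp_le always_eventually\<close>)
    with lt show False by (simp add: h\<psi>)
  qed
qed (rule v(5))

section \<open>Existence and uniqueness for the boundary value problem\<close>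

theorem theorem3p8:
  fixes \<Omega> :: "heis set" and f :: "heis \<Rightarrow> real" and K :: real
  assumes "open \<Omega>" and "connected \<Omega>" and "bounded \<Omega>"
    and "continuous_on (closure \<Omega>) f"
    and "\<forall>p\<in>frontier \<Omega>. f p = K"
    and "\<forall>p\<in>closure \<Omega>. f p \<le> K"
    and "\<exists>u_low. continuous_on (closure \<Omega>) u_low \<and> subsolution \<Omega> f u_low \<and>
           (\<forall>p\<in>frontier \<Omega>. u_low p = K)"
  shows "\<exists>w :: heis \<Rightarrow> real.
           (\<forall>p\<in>closure \<Omega>. usc_envelope (closure \<Omega>) (perron \<Omega> f) p = ereal (w p)) \<and>
           continuous_on (closure \<Omega>) w \<and>
           solution \<Omega> f w \<and>
           (\<forall>p\<in>closure \<Omega>. w p \<le> f p \<and> f p \<le> K) \<and>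
           (\<forall>p\<in>frontier \<Omega>. w p = f p \<and> f p = K) \<and>
           (\<forall>v :: heis \<Rightarrow> real.
              continuous_on (closure \<Omega>) v \<and>
              solution \<Omega> f v \<and>
              (\<forall>p\<in>closure \<Omega>. v p \<le> f p \<and> f p \<le> K) \<and>
              (\<forall>p\<in>frontier \<Omega>. v p = f p \<and> f p = K) \<longrightarrow>
              (\<forall>p\<in>closure \<Omega>. v p = w p))"
proof -
  let ?S = "closure \<Omega>"
  note op = assms(1) and bd = assms(3)
  note fK = assms(5)[rule_format] and fle = assms(6)[rule_format]
  obtain l where cl: "continuous_on ?S l" and subl: "subsolution \<Omega> f l"
    and lK: "\<And>p. p \<in> frontier \<Omega> \<Longrightarrow> l p = K"
    using assms(7) by blast
  have \<Omega>S: "x \<in> ?S" if "x \<in> \<Omega>" for x using that closure_subset by blast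
  have S\<Omega>: "x \<in> \<Omega> \<or> x \<in> frontier \<Omega>" if "x \<in> ?S" for x
    using that op by (auto simp: frontier_def interior_open)
  have FS: "x \<in> ?S" if "x \<in> frontier \<Omega>" for x using that by (simp add: frontier_def)
  have cf: "continuous_on \<Omega> f" using assms(4) closure_subset by (rule continuous_on_subset)
  have lbf: "locally_bounded_on \<Omega> f" using subl by (simp add: subsolution_def)
  define F where "F = {u. usc_on ?S u \<and> subsolution \<Omega> f u \<and> (\<forall>q\<in>frontier \<Omega>. u q \<le> f q)}"
  have perron: "perron \<Omega> f p = (SUP u\<in>F. ereal (u p))" for p
    by (simp add: perron_def F_def)
  have Ff: "u x \<le> f x" if "u \<in> F" "x \<in> ?S" for u x
    using S\<Omega>[OF that(2)] that(1) subsolution_le[OF op bd cf] unfolding F_def by blast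
  have lF: "l \<in> F" using cl subl lK fK by (simp add: F_def continuous_on_imp_usc_on)
  have "bounded (l ` ?S)"
    using cl bd by (intro compact_imp_bounded compact_continuous_image) auto
  then obtain b where b: "\<And>x. x \<in> ?S \<Longrightarrow> \<bar>l x\<bar> \<le> b"
    unfolding bounded_iff by (auto simp: real_norm_def)
  have lperron: "ereal (l p) \<le> perron \<Omega> f p" for p
    unfolding perron using lF by (rule SUP_upper)
  have lower: "ereal (- b) \<le> perron \<Omega> f p" if "p \<in> ?S" for p
    using lperron[of p] b[OF that] by (intro order_trans[OF _ lperron]) auto
  have upper: "perron \<Omega> f p \<le> ereal K" if "p \<in> ?S" for p
    unfolding perron using Ff[OF _ that] fle[OF that] by (intro SUP_least) (auto intro: order_trans)
  obtain w where env: "\<And>p. p \<in> ?S \<Longrightarrow> usc_envelope ?S (perron \<Omega> f) p = ereal (w p)"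
    and wusc: "usc_on ?S w" and pw: "\<And>p. p \<in> ?S \<Longrightarrow> perron \<Omega> f p \<le> ereal (w p)"
    and wb: "\<And>p. p \<in> ?S \<Longrightarrow> - b \<le> w p \<and> w p \<le> K"
    and wapp: "\<And>p d c. p \<in> ?S \<Longrightarrow> d > 0 \<Longrightarrow> c < w p \<Longrightarrow> \<exists>x\<in>?S. dist x p < d \<and> ereal c < perron \<Omega> f x"
    by (rule usc_envelope_real[of ?S "- b" "perron \<Omega> f" K, OF lower upper]) blast+
  have Fw: "u x \<le> w x" if "u \<in> F" "x \<in> ?S" for u x
  proof -
    have "ereal (u x) \<le> perron \<Omega> f x" unfolding perron using that(1) by (rule SUP_upper)
    also note pw[OF that(2)]
    finally show ?thesis by simp
  qed
  \<comment> \<open>The bound by f caps the envelope at K, and \<open>l\<close> supplies the reverse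
    inequality.\<close>
  have wK: "w x = K" if "x \<in> frontier \<Omega>" for x
    using wb[OF FS[OF that]] Fw[OF lF FS[OF that]] lK[OF that] by simp
  have wsub: "subsolution \<Omega> f w"
  proof (rule subsolution_usc_sup[where F = F, OF op cf lbf])
    show "locally_bounded_on \<Omega> w"
      using wb \<Omega>S by (intro locally_bounded_on_bounded[of _ "- b" _ K]) auto
    show "usc_on \<Omega> w" using wusc closure_subset by (rule usc_on_subset)
    fix p and d c :: real assume p: "p \<in> \<Omega>" "d > 0" "c < w p"
    \<comment> \<open>The approximating point is only known to lie in the closure; restricting the
      distance to a ball inside \<open>\<Omega>\<close> makes it interior.\<close>
    obtain r where r: "r > 0" "ball p r \<subseteq> \<Omega>" using op p(1) open_contains_ball by blast
    obtain x where x: "dist x p < min d r" "ereal c < perron \<Omega> f x"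
      using wapp[OF \<Omega>S[OF p(1)], of "min d r" c] p r(1) by auto
    obtain u where u: "u \<in> F" "c < u x"
      using x(2) unfolding perron less_SUP_iff by auto
    have "x \<in> \<Omega>" using x(1) by (intro subsetD[OF r(2)]) (simp add: dist_commute)
    with x(1) u show "\<exists>u\<in>F. \<exists>x\<in>\<Omega>. dist x p < d \<and> c < u x"
      by (intro bexI[of _ u] bexI[of _ x]) auto
  next
    show "subsolution \<Omega> f u" if "u \<in> F" for u using that by (simp add: F_def)
    show "u x \<le> w x" "u x \<le> f x" if "u \<in> F" "x \<in> \<Omega>" for u x
      using Fw[OF that(1)] Ff[OF that(1)] \<Omega>S[OF that(2)] by simp_all
  qed
  \<comment> \<open>A competitor with the boundary values of w equals K, hence f, on the frontier
    and so belongs to \<open>F\<close>.\<close>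
  have maximal: "\<forall>u. usc_on ?S u \<and> subsolution \<Omega> f u \<and> (\<forall>y\<in>frontier \<Omega>. u y = w y) \<longrightarrow>
      (\<forall>x\<in>\<Omega>. u x \<le> w x)"
    using Fw \<Omega>S wK fK by (simp add: F_def)
  have fleK: "f x \<le> K" if "x \<in> \<Omega>" for x using fle \<Omega>S[OF that] by simp
  have wlow: "- b \<le> w x" if "x \<in> \<Omega>" for x using wb[OF \<Omega>S[OF that]] by simp
  note super = maximal_subsolution_imp_supersolution[OF op bd cf fleK wusc wsub wlow maximal]
  \<comment> \<open>\<open>v'\<close> is the upper envelope of -w, so that -\<open>v'\<close> is the
    lower envelope of w.\<close>
  obtain v' where v'usc: "usc_on ?S v'" and v'w: "\<And>p. p \<in> ?S \<Longrightarrow> ereal (- w p) \<le> ereal (v' p)"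
    and v'b: "\<And>p. p \<in> ?S \<Longrightarrow> - K \<le> v' p \<and> v' p \<le> b"
    and v'app: "\<And>p d c. p \<in> ?S \<Longrightarrow> d > 0 \<Longrightarrow> c < v' p \<Longrightarrow> \<exists>x\<in>?S. dist x p < d \<and> ereal c < ereal (- w x)"
    by (rule usc_envelope_real[of ?S "- K" "\<lambda>x. ereal (- w x)" b]) (use wb in force)+
  define v where "v = (\<lambda>x. - v' x)"
  have vlsc: "lsc_on ?S v" using v'usc by (simp add: v_def lsc_on_uminus)
  have vw: "v p \<le> w p" if "p \<in> ?S" for p using v'w[OF that] by (simp add: v_def)
  have vapp: "\<exists>x\<in>?S. dist x p < d \<and> w x < c" if "p \<in> ?S" "d > 0" "v p < c" for p d c
    using v'app[of p d "- c"] that by (auto simp: v_def)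
  \<comment> \<open>Continuity of \<open>l\<close> carries its bound from w to the lower envelope.
    This gives v the boundary value required by comparison.\<close>
  have lv: "l p \<le> v p" if p: "p \<in> ?S" for p
  proof (rule ccontr)
    assume "\<not> ?thesis"
    then obtain c where c: "v p < c" "- l p < - c" using dense[of "v p" "l p"] by auto
    obtain d where d: "d > 0" "\<And>x. x \<in> ?S \<Longrightarrow> dist x p < d \<Longrightarrow> - l x < - c"
      using continuous_on_imp_lsc_on[OF cl] c(2) p unfolding lsc_on_uminus usc_on_dist by blast
    obtain x where "x \<in> ?S" "dist x p < d" "w x < c" using vapp[OF p d(1) c(1)] by blast
    with d(2)[of x] Fw[OF lF, of x] show False by simp
  qed
  have vK: "K \<le> v x" if "x \<in> frontier \<Omega>" for x using lv[OF FS[OF that]] lK[OF that] by simp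
  have vsuper: "supersolution \<Omega> f v"
  proof (rule super[OF _ _ _ _ vlsc vK])
    show "locally_bounded_on \<Omega> v"
      using v'b \<Omega>S by (intro locally_bounded_on_bounded[of _ "- b" _ K]) (fastforce simp: v_def)+
    fix p and d c :: real assume p: "p \<in> \<Omega>" "d > 0" "v p < c"
    obtain r where r: "r > 0" "ball p r \<subseteq> \<Omega>" using op p(1) open_contains_ball by blast
    obtain x where "dist x p < min d r" "w x < c"
      using vapp[OF \<Omega>S[OF p(1)], of "min d r" c] p r(1) by auto
    moreover from this have "x \<in> \<Omega>" by (intro subsetD[OF r(2)]) (simp add: dist_commute)
    ultimately show "\<exists>x\<in>\<Omega>. dist x p < d \<and> w x < c" by (intro bexI[of _ x]) simp_all
  qed (simp_all add: vw \<Omega>S)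
  have "w x \<le> v x" if "x \<in> ?S" for x
    by (rule comparison[OF op bd cf wusc wsub _ vlsc vsuper vK that]) (simp add: wb)
  then have wv: "w x = v x" if "x \<in> ?S" for x by (rule antisym) (simp_all add: vw that)
  have wlsc: "lsc_on ?S w"
    using vlsc wv unfolding lsc_on_uminus usc_on_dist by simp
  \<comment> \<open>The same lemma with w in the place of v; the approximating point is now p
    itself.\<close>
  have wsuper: "supersolution \<Omega> f w"
  proof (rule super[OF _ _ _ _ wlsc])
    show "locally_bounded_on \<Omega> w" using wsub by (simp add: subsolution_def)
    show "\<exists>x\<in>\<Omega>. dist x p < d \<and> w x < c" if "p \<in> \<Omega>" "d > 0" "w p < c" for p d c
      using that by (intro bexI[of _ p]) auto
  qed (use wK in auto)
  have cw: "continuous_on ?S w" using wusc wlsc by (rule usc_lsc_imp_continuous_on)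
  have sol: "solution \<Omega> f w"
    using wsub wsuper continuous_on_subset[OF cw closure_subset] by (simp add: solution_def)
  \<comment> \<open>Being a subsolution with value K on the frontier, w is itself a member of
    \<open>F\<close>.\<close>
  have wf: "w x \<le> f x" if "x \<in> ?S" for x
    using Ff[OF _ that, of w] wusc wsub wK fK by (simp add: F_def)
  show ?thesis
  proof (intro exI[of _ w] conjI ballI allI impI env cw sol)
    fix z p assume z: "continuous_on ?S z \<and> solution \<Omega> f z \<and> (\<forall>p\<in>?S. z p \<le> f p \<and> f p \<le> K) \<and>
        (\<forall>p\<in>frontier \<Omega>. z p = f p \<and> f p = K)" and p: "p \<in> ?S"
    then have zsol: "subsolution \<Omega> f z" "supersolution \<Omega> f z"
      and zs: "usc_on ?S z" "lsc_on ?S z"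
      by (auto simp: solution_def continuous_on_imp_usc_on continuous_on_imp_lsc_on)
    have "z p \<le> w p"
      by (rule comparison[OF op bd cf zs(1) zsol(1) _ wlsc wsuper _ p, of K]) (use z wK in force)+
    moreover have "w p \<le> z p"
      by (rule comparison[OF op bd cf wusc wsub _ zs(2) zsol(2) _ p, of K]) (use z wb in force)+
    ultimately show "z p = w p" by simp
  qed (use wf fle fK wK in auto)
qed

end
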